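(* Let $G$ be a connected graph. Then the following statements are equivalent: (B1) $G$ is $\{\text{pan}, \text{diamond}\}$-free; (B2) every DFS ordering of $G$ is a LexDFS ordering of $G$; (B3) every BFS ordering of $G$ is a LexBFS ordering of $G$; (B4) every graph search ordering of $G$ is an MNS ordering of $G$.
   Context: All graphs are finite and simple. For an ordering $\sigma$ of $V(G)$ write $x<_\sigma y$ if $x$ precedes $y$. A graph search ordering of $G$ is an ordering of $V(G)$ such that every prefix induces a connected subgraph. In each of the following, the condition is required for all $a<_\sigma b<_\sigma c$ with $ac\in E(G)$ and $ab\notin E(G)$: $\sigma$ is a BFS ordering if there is $d$ with $d<_\sigma a$ and $db\in E(G)$; a DFS ordering if there is $d$ with $a<_\sigma d<_\sigma b$ and $db\in E(G)$; a LexBFS ordering if there is $d$ with $d<_\sigma a$, $db\in E(G)$, $dc\notin E(G)$; a LexDFS ordering if there is $d$ with $a<_\sigma d<_\sigma b$, $db\in E(G)$, $dc\notin E(G)$; an MNS ordering if there is $d$ with $d<_\sigma b$, $db\in E(G)$, $dc\notin E(G)$. For $k\ge 3$, a $k$-pan is a cycle of length $k$ together with one extra vertex adjacent to exactly one vertex of the cycle; a pan is a $k$-pan for some $k\ge3$, and pan-free means containing no $k$-pan as an induced subgraph for any $k\ge 3$. The diamond is $K_4$ minus one edge. $\{\text{pan},\text{diamond}\}$-free means no induced pan and no induced diamond. *)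

theory Defs
  imports "Graph_Theory.Graph_Theory"
begin

text \<open>
  A finite simple graph is a \<^locale>\<open>pair_graph\<close>: finitely many vertices and a symmetric,
  loop-free set of arcs without multiplicities; \<open>uv\<close> is an edge iff \<open>(u, v) \<in> parcs G\<close>.
\<close>

definition vertex_ordering :: "'a pair_pre_digraph \<Rightarrow> 'a list \<Rightarrow> bool" where
  "vertex_ordering G \<sigma> \<longleftrightarrow> distinct \<sigma> \<and> set \<sigma> = pverts G"

definition precedes :: "'a list \<Rightarrow> 'a \<Rightarrow> 'a \<Rightarrow> bool" where
  "precedes \<sigma> x y \<longleftrightarrow> (\<exists>i j. i < j \<and> j < length \<sigma> \<and> \<sigma> ! i = x \<and> \<sigma> ! j = y)"

text \<open>
  The empty prefix is excluded, because \<^const>\<open>connected\<close> demands a nonempty vertex set.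
\<close>

definition graph_search_ordering :: "'a pair_pre_digraph \<Rightarrow> 'a list \<Rightarrow> bool" where
  "graph_search_ordering G \<sigma> \<longleftrightarrow> vertex_ordering G \<sigma> \<and>
    (\<forall>k. 1 \<le> k \<and> k \<le> length \<sigma> \<longrightarrow> connected (with_proj G \<restriction> set (take k \<sigma>)))"

definition BFS_ordering :: "'a pair_pre_digraph \<Rightarrow> 'a list \<Rightarrow> bool" where
  "BFS_ordering G \<sigma> \<longleftrightarrow> vertex_ordering G \<sigma> \<and>
    (\<forall>a b c. precedes \<sigma> a b \<and> precedes \<sigma> b c \<and> (a, c) \<in> parcs G \<and> (a, b) \<notin> parcs G \<longrightarrow>
      (\<exists>d. precedes \<sigma> d a \<and> (d, b) \<in> parcs G))"

definition DFS_ordering :: "'a pair_pre_digraph \<Rightarrow> 'a list \<Rightarrow> bool" where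
  "DFS_ordering G \<sigma> \<longleftrightarrow> vertex_ordering G \<sigma> \<and>
    (\<forall>a b c. precedes \<sigma> a b \<and> precedes \<sigma> b c \<and> (a, c) \<in> parcs G \<and> (a, b) \<notin> parcs G \<longrightarrow>
      (\<exists>d. precedes \<sigma> a d \<and> precedes \<sigma> d b \<and> (d, b) \<in> parcs G))"

definition LexBFS_ordering :: "'a pair_pre_digraph \<Rightarrow> 'a list \<Rightarrow> bool" where
  "LexBFS_ordering G \<sigma> \<longleftrightarrow> vertex_ordering G \<sigma> \<and>
    (\<forall>a b c. precedes \<sigma> a b \<and> precedes \<sigma> b c \<and> (a, c) \<in> parcs G \<and> (a, b) \<notin> parcs G \<longrightarrow>
      (\<exists>d. precedes \<sigma> d a \<and> (d, b) \<in> parcs G \<and> (d, c) \<notin> parcs G))"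

definition LexDFS_ordering :: "'a pair_pre_digraph \<Rightarrow> 'a list \<Rightarrow> bool" where
  "LexDFS_ordering G \<sigma> \<longleftrightarrow> vertex_ordering G \<sigma> \<and>
    (\<forall>a b c. precedes \<sigma> a b \<and> precedes \<sigma> b c \<and> (a, c) \<in> parcs G \<and> (a, b) \<notin> parcs G \<longrightarrow>
      (\<exists>d. precedes \<sigma> a d \<and> precedes \<sigma> d b \<and> (d, b) \<in> parcs G \<and> (d, c) \<notin> parcs G))"

definition MNS_ordering :: "'a pair_pre_digraph \<Rightarrow> 'a list \<Rightarrow> bool" where
  "MNS_ordering G \<sigma> \<longleftrightarrow> vertex_ordering G \<sigma> \<and>
    (\<forall>a b c. precedes \<sigma> a b \<and> precedes \<sigma> b c \<and> (a, c) \<in> parcs G \<and> (a, b) \<notin> parcs G \<longrightarrow>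
      (\<exists>d. precedes \<sigma> d b \<and> (d, b) \<in> parcs G \<and> (d, c) \<notin> parcs G))"

definition contains_induced :: "'a pair_pre_digraph \<Rightarrow> 'b pair_pre_digraph \<Rightarrow> bool" where
  "contains_induced G H \<longleftrightarrow>
    (\<exists>S \<subseteq> pverts G. digraph_iso (with_proj H) (with_proj G \<restriction> S))"

text \<open>The cycle is \<open>0, 1, \<dots>, k - 1\<close>; the extra vertex is \<open>k\<close>, attached to \<open>0\<close>.\<close>

definition pan :: "nat \<Rightarrow> nat pair_pre_digraph" where
  "pan k = \<lparr> pverts = {0..k},
     parcs = {(i, j). i < k \<and> j < k \<and> (j = (i + 1) mod k \<or> i = (j + 1) mod k)}
       \<union> {(0, k), (k, 0)} \<rparr>"

definition diamond :: "nat pair_pre_digraph" where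
  "diamond = \<lparr> pverts = {0..3},
     parcs = {(i, j). i \<le> 3 \<and> j \<le> 3 \<and> i \<noteq> j} - {(0, 1), (1, 0)} \<rparr>"

definition pan_diamond_free :: "'a pair_pre_digraph \<Rightarrow> bool" where
  "pan_diamond_free G \<longleftrightarrow>
    (\<forall>k\<ge>3. \<not> contains_induced G (pan k)) \<and> \<not> contains_induced G diamond"

end

theory Submission
  imports Defs
begin

text \<open>
  Everything rests on one fact about a graph without induced diamonds and small pans: if
  \<open>a c d b\<close> is a walk with \<open>a \<noteq> d\<close> and \<open>b \<noteq> c\<close>, and \<open>a\<close> and \<open>d\<close> are joined by a short walk avoiding
  \<open>b\<close> and \<open>c\<close>, then \<open>a b\<close> is an edge. In a search ordering the vertices preceding \<open>b\<close> are connected,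
  so every earlier neighbour \<open>d\<close> of \<open>b\<close> supplied by the search is not adjacent to \<open>c\<close> when \<open>a c\<close> is
  an edge and \<open>a b\<close> is not; this turns each search into its lexicographic version.

  Conversely, running a depth-first search first along the path that remains of the pan after
  deleting a cycle neighbour of the branch vertex (or along the induced path \<open>x u y\<close> of a diamond)
  violates LexDFS and MNS. For breadth-first search take a smallest pan with cycle
  \<open>c\<^sub>0, \<dots>, c\<^sub>k\<^sub>-\<^sub>1\<close> and pendant vertex \<open>w\<close> at \<open>c\<^sub>0\<close>. Its cycle is isometric. Start the search with the
  edge of the cycle opposite to \<open>c\<^sub>1\<close>. Then \<open>c\<^sub>1\<close> and \<open>w\<close> have the same first neighbour, so that either
  may be visited first among the vertices it discovers, whereas \<open>c\<^sub>2\<close>, visited before, is adjacent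
  to \<open>c\<^sub>1\<close> only: some choice is not lexicographic.
\<close>

section \<open>Walks\<close>

text \<open>Both ends lie in \<open>S\<close> and the length is exact, because the arguments below
  avoid two given vertices and compare lengths with that of a cycle. Vertices may repeat, so walks
  concatenate freely.\<close>

primrec walk_in :: "('a \<times> 'a) set \<Rightarrow> 'a set \<Rightarrow> nat \<Rightarrow> 'a \<Rightarrow> 'a \<Rightarrow> bool" where
  "walk_in E S 0 x y \<longleftrightarrow> x \<in> S \<and> x = y"
| "walk_in E S (Suc l) x y \<longleftrightarrow> x \<in> S \<and> (\<exists>z. (x, z) \<in> E \<and> walk_in E S l z y)"

lemma walk_in_mono: "walk_in E S l x y \<Longrightarrow> S \<subseteq> T \<Longrightarrow> walk_in E T l x y"
  by (induction l arbitrary: x) auto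

lemma walk_in_start: "walk_in E S l x y \<Longrightarrow> x \<in> S"
  by (cases l) auto

lemma walk_in_end: "walk_in E S l x y \<Longrightarrow> y \<in> S"
  by (induction l arbitrary: x) auto

lemma walk_in_append: "walk_in E S l x y \<Longrightarrow> walk_in E S m y z \<Longrightarrow> walk_in E S (l + m) x z"
  by (induction l arbitrary: x) auto

lemma walk_in_edge: "x \<in> S \<Longrightarrow> y \<in> S \<Longrightarrow> (x, y) \<in> E \<Longrightarrow> walk_in E S 1 x y"
  by auto

lemma walk_in_snoc:
  assumes "walk_in E S l x y" "(y, z) \<in> E" "z \<in> S"
  shows "walk_in E S (Suc l) x z"
  using walk_in_append[OF assms(1) walk_in_edge[OF walk_in_end[OF assms(1)] assms(3,2)]] by simp

lemma walk_in_rev: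
  assumes "sym E" "walk_in E S l x y"
  shows "walk_in E S l y x"
  using assms(2)
proof (induction l arbitrary: x)
  case (Suc l)
  then obtain z where "x \<in> S" "(x, z) \<in> E" "walk_in E S l z y" by auto
  with Suc.IH show ?case by (meson assms(1) symD walk_in_snoc)
qed auto

text \<open>In this form explicit walks along a cycle are exhibited and positions on a walk are
  compared.\<close>

lemma walk_in_iff_fun:
  "walk_in E S l x y \<longleftrightarrow>
    (\<exists>p. p 0 = x \<and> p l = y \<and> (\<forall>i<l. (p i, p (Suc i)) \<in> E) \<and> (\<forall>i\<le>l. p i \<in> S))"
proof (induction l arbitrary: x)
  case (Suc l)
  show ?case (is "?L \<longleftrightarrow> ?R")
  proof
    assume ?L
    then obtain z where z: "x \<in> S" "(x, z) \<in> E" "walk_in E S l z y" by auto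
    then obtain p where "p 0 = z" "p l = y" "\<forall>i<l. (p i, p (Suc i)) \<in> E" "\<forall>i\<le>l. p i \<in> S"
      using Suc.IH by blast
    with z show ?R
      by (intro exI[of _ "case_nat x p"]) (auto split: nat.splits)
  next
    assume ?R
    then obtain p where p: "p 0 = x" "p (Suc l) = y" "\<forall>i<Suc l. (p i, p (Suc i)) \<in> E"
      "\<forall>i\<le>Suc l. p i \<in> S" by blast
    then have "walk_in E S l (p 1) y"
      using Suc.IH[of "p 1"] by (auto intro!: exI[of _ "\<lambda>i. p (Suc i)"])
    with p show ?L by auto
  qed
qed auto

lemma walk_in_segment:
  assumes "\<forall>i<l. (p i, p (Suc i)) \<in> E" "\<forall>i\<le>l. p i \<in> S" "i \<le> j" "j \<le> l"
  shows "walk_in E S (j - i) (p i) (p j)"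
  unfolding walk_in_iff_fun using assms by (intro exI[of _ "\<lambda>t. p (i + t)"]) auto

section \<open>Induced cycles and pans\<close>

definition induced_cycle :: "('a \<times> 'a) set \<Rightarrow> nat \<Rightarrow> (nat \<Rightarrow> 'a) \<Rightarrow> bool" where
  "induced_cycle E k c \<longleftrightarrow> inj_on c {..<k} \<and>
    (\<forall>i<k. \<forall>j<k. (c i, c j) \<in> E \<longleftrightarrow> (j = (i + 1) mod k \<or> i = (j + 1) mod k))"

definition induced_pan :: "('a \<times> 'a) set \<Rightarrow> nat \<Rightarrow> (nat \<Rightarrow> 'a) \<Rightarrow> 'a \<Rightarrow> bool" where
  "induced_pan E k c w \<longleftrightarrow> 3 \<le> k \<and> induced_cycle E k c \<and> w \<notin> c ` {..<k} \<and>
    (\<forall>i<k. (c i, w) \<in> E \<longleftrightarrow> i = 0)"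

text \<open>Here \<open>u\<close> and \<open>v\<close> are the vertices of degree three. In a
  loop-free graph all pairs except \<open>x\<close> and \<open>y\<close> are distinct by
  adjacency.\<close>

definition no_diamond :: "('a \<times> 'a) set \<Rightarrow> bool" where
  "no_diamond E \<longleftrightarrow> (\<forall>x y u v. (u, v) \<in> E \<and> (x, u) \<in> E \<and> (x, v) \<in> E \<and> (y, u) \<in> E \<and> (y, v) \<in> E
     \<longrightarrow> x = y \<or> (x, y) \<in> E)"

text \<open>The bound serves two uses: for all \<open>n\<close> it expresses that the graph is
  pan-free, and for \<open>n = k\<close> that a given pan with cycle length \<open>k\<close> is a
  smallest one.\<close>

definition no_pan_below :: "('a \<times> 'a) set \<Rightarrow> nat \<Rightarrow> bool" where
  "no_pan_below E n \<longleftrightarrow> (\<forall>k c w. k < n \<longrightarrow> \<not> induced_pan E k c w)"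

text \<open>For increasing indices the only wrap-around edge joins the first and the last one. This
  removes \<open>mod\<close> from later case distinctions.\<close>

lemma cycle_adjacent_iff:
  fixes i j k :: nat
  assumes "i < j" "j < k"
  shows "(j = (i + 1) mod k \<or> i = (j + 1) mod k) \<longleftrightarrow> j = Suc i \<or> (i = 0 \<and> j = k - 1)"
proof -
  have 1: "(i + 1) mod k = i + 1" using assms by simp
  show ?thesis
  proof (cases "j = k - 1")
    case True
    then have "j + 1 = k" using assms by simp
    with 1 show ?thesis by auto
  next
    case False
    then have "(j + 1) mod k = j + 1" using assms by simp
    with 1 False assms show ?thesis by auto
  qed
qed

lemma induced_cycleI:
  assumes "sym E" "irrefl E" "2 \<le> k"
    and "\<And>i j. i < j \<Longrightarrow> j < k \<Longrightarrow> c i \<noteq> c j"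
    and "\<And>i j. i < j \<Longrightarrow> j < k \<Longrightarrow> (c i, c j) \<in> E \<longleftrightarrow> j = Suc i \<or> (i = 0 \<and> j = k - 1)"
  shows "induced_cycle E k c"
  unfolding induced_cycle_def
proof (intro conjI allI impI)
  show "inj_on c {..<k}"
    by (rule linorder_inj_onI) (use assms(4) in auto)
next
  fix i j assume ij: "i < k" "j < k"
  show "(c i, c j) \<in> E \<longleftrightarrow> (j = (i + 1) mod k \<or> i = (j + 1) mod k)"
  proof (cases i j rule: linorder_cases)
    case less
    with ij show ?thesis using assms(5) cycle_adjacent_iff by metis
  next
    case equal
    have "i \<noteq> (i + 1) mod k" using ij assms(3)
      by (cases "i + 1 = k") auto
    with equal show ?thesis using assms(2) by (auto simp: irrefl_def)
  next
    case greater
    with ij have "(c j, c i) \<in> E \<longleftrightarrow> (i = (j + 1) mod k \<or> j = (i + 1) mod k)"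
      using assms(5) cycle_adjacent_iff by metis
    moreover have "(c j, c i) \<in> E \<longleftrightarrow> (c i, c j) \<in> E" using assms(1) by (auto dest: symD)
    ultimately show ?thesis by blast
  qed
qed

lemma induced_cycle_edge_iff:
  assumes "induced_cycle E k c" "i < j" "j < k"
  shows "(c i, c j) \<in> E \<longleftrightarrow> j = Suc i \<or> (i = 0 \<and> j = k - 1)"
  using assms cycle_adjacent_iff[OF assms(2,3)] unfolding induced_cycle_def by simp

lemma induced_cycle_neq: "induced_cycle E k c \<Longrightarrow> i < k \<Longrightarrow> j < k \<Longrightarrow> i \<noteq> j \<Longrightarrow> c i \<noteq> c j"
  unfolding induced_cycle_def inj_on_def by blast

section \<open>Pendant vertices on short closed walks\<close>

lemma no_paw:
  assumes E: "sym E" "irrefl E" and nd: "no_diamond E" and np: "no_pan_below E n" and n: "3 < n"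
    and "(x, y) \<in> E" "(y, z) \<in> E" "(x, z) \<in> E" "(x, w) \<in> E" "w \<noteq> y" "w \<noteq> z"
  shows "(y, w) \<in> E \<and> (z, w) \<in> E"
proof -
  have neq: "x \<noteq> y" "y \<noteq> z" "x \<noteq> z" "x \<noteq> w" using assms by (auto simp: irrefl_def)
  define c where "c i = (if i = 0 then x else if i = (1::nat) then y else z)" for i
  have lt3: "i < 3 \<longleftrightarrow> i = 0 \<or> i = 1 \<or> i = 2" for i :: nat by auto
  have cyc: "induced_cycle E 3 c"
    by (rule induced_cycleI) (use assms neq in \<open>auto simp: c_def lt3\<close>)
  \<comment> \<open>Without both edges \<open>w\<close> hangs off the triangle as an induced 3-pan;
    with exactly one of them a diamond appears.\<close>
  have "(y, w) \<in> E \<or> (z, w) \<in> E"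
  proof (rule ccontr)
    assume *: "\<not> ((y, w) \<in> E \<or> (z, w) \<in> E)"
    have "induced_pan E 3 c w" unfolding induced_pan_def
      using cyc * assms neq by (auto simp: c_def lt3)
    with np n show False unfolding no_pan_below_def by blast
  qed
  moreover have "(y, w) \<in> E \<Longrightarrow> (z, w) \<in> E"
    using nd assms unfolding no_diamond_def by (meson symD)
  moreover have "(z, w) \<in> E \<Longrightarrow> (y, w) \<in> E"
    using nd assms unfolding no_diamond_def by (meson symD)
  ultimately show ?thesis by blast
qed

text \<open>Cut out the part between \<open>i\<close> and \<open>j\<close>, or replace it by the
  chord. Hence a shortest walk is an induced path.\<close>

lemma walk_in_shortcut:
  assumes p: "p 0 = x" "p l = y" "\<forall>i<l. (p i, p (Suc i)) \<in> E" "\<forall>i\<le>l. p i \<in> S"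
    and ij: "i < j" "j \<le> l" and short: "p i = p j \<or> (Suc i < j \<and> (p i, p j) \<in> E)"
  shows "\<exists>l'<l. walk_in E S l' x y"
proof -
  have 1: "walk_in E S i x (p i)"
    using walk_in_segment[OF p(3,4), of 0 i] p(1) ij by simp
  have 2: "walk_in E S (l - j) (p j) y"
    using walk_in_segment[OF p(3,4), of j l] p(2) ij by simp
  from short show ?thesis
  proof
    assume "p i = p j"
    then have "walk_in E S (i + (l - j)) x y" using walk_in_append 1 2 by metis
    then show ?thesis using ij by (intro exI[of _ "i + (l - j)"]) auto
  next
    assume s: "Suc i < j \<and> (p i, p j) \<in> E"
    then have "walk_in E S (Suc i) x (p j)" using walk_in_snoc[OF 1] p(4) ij by auto
    then have "walk_in E S (Suc i + (l - j)) x y" using walk_in_append 2 by metis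
    then show ?thesis using ij s by (intro exI[of _ "Suc i + (l - j)"]) auto
  qed
qed

text \<open>
  A walk from \<open>a\<close> to \<open>d\<close> closes up through \<open>c\<close> to a cycle with the pendant vertex \<open>b\<close>
  at \<open>d\<close>; a shortest counterexample would be an induced pan.
\<close>

lemma closed_walk_pendant_adjacent:
  assumes E: "sym E" "irrefl E" and nd: "no_diamond E" and np: "no_pan_below E n"
  shows "walk_in E (- {b, c}) m a d \<Longrightarrow> m + 2 < n \<Longrightarrow> (a, c) \<in> E \<Longrightarrow> (c, d) \<in> E \<Longrightarrow> (d, b) \<in> E
    \<Longrightarrow> a \<noteq> d \<Longrightarrow> b \<noteq> c \<Longrightarrow> (a, b) \<in> E"
proof (induction m arbitrary: a b c d rule: less_induct)
  case (less m)
  note walk = less.prems(1) and mn = less.prems(2) and ac = less.prems(3) and cd = less.prems(4)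
    and db = less.prems(5) and ad = less.prems(6) and bc = less.prems(7)
  have sm: "(x, y) \<in> E \<longleftrightarrow> (y, x) \<in> E" for x y using E(1) by (auto dest: symD)
  have ab: "a \<noteq> b" "d \<noteq> c" "a \<noteq> c" "d \<noteq> b" using walk_in_start[OF walk] walk_in_end[OF walk] by auto
  obtain p where p: "p 0 = a" "p m = d" "\<forall>i<m. (p i, p (Suc i)) \<in> E" "\<forall>i\<le>m. p i \<in> - {b, c}"
    using walk unfolding walk_in_iff_fun by blast
  have m0: "m > 0" using p(1,2) ad by (cases m) auto
  have n3: "3 < n" using m0 mn by auto
  show ?case
  proof (rule ccontr)
    assume nab: "(a, b) \<notin> E"
    \<comment> \<open>By the induction hypothesis a shorter walk would already give the edge, so the
      walk is shortest and \<open>p\<close> has neither repetitions nor chords.\<close>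
    have nshort: "\<not> walk_in E (- {b, c}) l a d" if "l < m" for l
      using less.IH[OF that _ _ ac cd db ad bc] nab that mn by auto
    have noshort: "p i \<noteq> p j \<and> \<not> (Suc i < j \<and> (p i, p j) \<in> E)" if "i < j" "j \<le> m" for i j
      using walk_in_shortcut[OF p that] nshort by blast
    \<comment> \<open>An edge from \<open>a\<close> to \<open>d\<close> would close the triangle
      \<open>a\<close>, \<open>c\<close>, \<open>d\<close> with \<open>b\<close> attached at
      \<open>d\<close>. Likewise an edge from \<open>b\<close> to \<open>c\<close> would close the
      triangle \<open>b\<close>, \<open>c\<close>, \<open>d\<close> with \<open>a\<close> attached
      at \<open>c\<close>.\<close>
    have nad: "(a, d) \<notin> E"
    proof
      assume "(a, d) \<in> E"
      then have "(a, b) \<in> E"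
        using no_paw[OF E nd np n3, of d a c b] ac cd db ab bc sm by blast
      with nab show False by blast
    qed
    have nbc: "(b, c) \<notin> E"
    proof
      assume "(b, c) \<in> E"
      then have "(a, b) \<in> E"
        using no_paw[OF E nd np n3, of c b d a] ac cd db ab ad sm by blast
      with nab show False by blast
    qed
    have m2: "2 \<le> m"
    proof (rule ccontr)
      assume "\<not> 2 \<le> m"
      then have "m = 1" using m0 by auto
      then show False using p nad by auto
    qed
    \<comment> \<open>A neighbour \<open>p i\<close> of \<open>c\<close> splits the closed walk into
      two shorter ones: the part through \<open>d\<close> makes \<open>p i\<close> adjacent to
      \<open>b\<close>, and then the part through \<open>a\<close> makes \<open>a\<close> adjacent
      to \<open>b\<close>.\<close>
    have nc: "(c, p i) \<notin> E" if "0 < i" "i < m" for i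
    proof
      assume ci: "(c, p i) \<in> E"
      have w1: "walk_in E (- {b, c}) (m - i) (p i) d"
        using walk_in_segment[OF p(3,4), of i m] p(2) that by simp
      have w2: "walk_in E (- {b, c}) i a (p i)"
        using walk_in_segment[OF p(3,4), of 0 i] p(1) that by simp
      have "p i \<noteq> d" "a \<noteq> p i" using noshort[of i m] noshort[of 0 i] p that by auto
      then have "(p i, b) \<in> E"
        using less.IH[OF _ w1] ci cd db bc sm that mn by auto
      then have "(a, b) \<in> E"
        using less.IH[OF _ w2] ci ac bc \<open>a \<noteq> p i\<close> that mn by auto
      with nab show False by blast
    qed
    \<comment> \<open>For \<open>i > 0\<close> the roles of \<open>b\<close> and \<open>c\<close>
      are exchanged: the walk \<open>p i\<close>, \<open>b\<close>, \<open>d\<close>,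
      \<open>c\<close> makes \<open>p i\<close> adjacent to \<open>c\<close>, which
      \<open>nc\<close> excludes.\<close>
    have nb: "(b, p i) \<notin> E" if "i < m" for i
    proof (cases "i = 0")
      case True
      then show ?thesis using nab sm p by auto
    next
      case False
      show ?thesis
      proof
        assume bi: "(b, p i) \<in> E"
        have "walk_in E (- {c, b}) (m - i) (p i) d"
          using walk_in_segment[OF p(3,4), of i m] p(2) that by (simp add: insert_commute)
        moreover have "p i \<noteq> d" using noshort[of i m] p that by auto
        ultimately have "(p i, c) \<in> E"
          using less.IH[of "m - i" c b "p i" d] bi cd db bc sm that mn False by auto
        with nc[of i] False that sm show False by blast
      qed
    qed
    \<comment> \<open>The path is reversed so that \<open>d\<close>, the neighbour of
      \<open>b\<close>, gets index 0 as in \<open>induced_pan\<close>; \<open>c\<close> closes the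
      cycle at index \<open>m + 1\<close>.\<close>
    define q where "q i = (if i \<le> m then p (m - i) else c)" for i
    have "induced_cycle E (m + 2) q"
    proof (rule induced_cycleI)
      fix i j assume ij: "i < j" "j < m + 2"
      have "m - j < m - i" if "j \<le> m" using ij that by simp
      then show "q i \<noteq> q j"
        using noshort[of "m - j" "m - i"] p(4) ij by (cases "j \<le> m") (auto simp: q_def)
      show "(q i, q j) \<in> E \<longleftrightarrow> j = Suc i \<or> (i = 0 \<and> j = m + 2 - 1)"
      proof (cases "j \<le> m")
        case True
        show ?thesis
        proof (cases "j = Suc i")
          case True
          then have "Suc (m - j) = m - i" using \<open>j \<le> m\<close> by auto
          then have "(p (m - j), p (m - i)) \<in> E"
            using p(3)[rule_format, of "m - j"] True \<open>j \<le> m\<close> by auto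
          then show ?thesis using True \<open>j \<le> m\<close> sm by (auto simp: q_def)
        next
          case False
          then have "(p (m - j), p (m - i)) \<notin> E" using noshort[of "m - j" "m - i"] True ij by auto
          then show ?thesis using True False ij sm by (auto simp: q_def)
        qed
      next
        case False
        then have j: "j = Suc m" "i \<le> m" using ij by auto
        have "(p (m - i), c) \<in> E \<longleftrightarrow> i = m \<or> i = 0"
        proof (cases "i = 0 \<or> i = m")
          case True then show ?thesis using ac cd p(1,2) sm by auto
        next
          case False
          then show ?thesis using nc[of "m - i"] j sm by auto
        qed
        then show ?thesis using j by (auto simp: q_def)
      qed
    qed (use E in auto)
    moreover have "q i \<noteq> b" for i using p(4) bc by (auto simp: q_def)
    then have "b \<notin> q ` {..<m + 2}" by blast
    moreover have "(q i, b) \<in> E \<longleftrightarrow> i = 0" if "i < m + 2" for i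
    proof (cases "i = 0")
      case True then show ?thesis using p(2) db by (auto simp: q_def)
    next
      case False
      then show ?thesis using nb[of "m - i"] nbc sm m0 by (auto simp: q_def)
    qed
    ultimately have "induced_pan E (m + 2) q b"
      using m2 unfolding induced_pan_def by auto
    then show False using np mn unfolding no_pan_below_def by blast
  qed
qed

section \<open>Connectivity and induced subgraphs\<close>

lemma rtrancl_on_iff_walk_in: "(x, y) \<in> rtrancl_on S R \<longleftrightarrow> (\<exists>l. walk_in R S l x y)"
proof
  assume "(x, y) \<in> rtrancl_on S R"
  then show "\<exists>l. walk_in R S l x y"
  proof induction
    case base
    then have "walk_in R S 0 y y" by simp
    then show ?case by blast
  next
    case (step x z)
    then obtain l where "walk_in R S (Suc l) x y" by auto
    then show ?case by blast
  qed
next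
  have "walk_in R S l x y \<Longrightarrow> (x, y) \<in> rtrancl_on S R" for l
  proof (induction l arbitrary: x)
    case (Suc l)
    then obtain z where "x \<in> S" "(x, z) \<in> R" "(z, y) \<in> rtrancl_on S R" by auto
    then show ?case by (meson converse_rtrancl_on_into_rtrancl_on)
  qed auto
  then show "\<exists>l. walk_in R S l x y \<Longrightarrow> (x, y) \<in> rtrancl_on S R" by blast
qed

lemma walk_in_restrict: "walk_in {(x, y) \<in> R. x \<in> S \<and> y \<in> S} S l x y \<longleftrightarrow> walk_in R S l x y"
  by (induction l arbitrary: x) (auto dest: walk_in_start)

text \<open>The arcs being symmetric, \<open>mk_symmetric\<close> adds none, and strong connectivity
  of the induced subgraph becomes the existence of walks inside \<open>S\<close>.\<close>

lemma connected_induce_iff_walk_in: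
  assumes "sym (parcs G)"
  shows "connected (with_proj G \<restriction> S) \<longleftrightarrow>
    S \<noteq> {} \<and> (\<forall>x\<in>S. \<forall>y\<in>S. \<exists>l. walk_in (parcs G) S l x y)"
proof -
  have 1: "parcs (mk_symmetric (with_proj G \<restriction> S)) = {(x, y) \<in> parcs G. x \<in> S \<and> y \<in> S}"
    using assms by (auto simp: mk_symmetric_def induce_subgraph_def dest: symD)
  have 2: "pverts (mk_symmetric (with_proj G \<restriction> S)) = S"
    by (auto simp: mk_symmetric_def)
  show ?thesis
    unfolding connected_def strongly_connected_def reachable_def with_proj_simps 1 2
      rtrancl_on_iff_walk_in walk_in_restrict ..
qed

lemma connected_iff_walk_in:
  assumes "sym (parcs G)" "pair_wf_digraph G"
  shows "connected (with_proj G) \<longleftrightarrow>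
    pverts G \<noteq> {} \<and> (\<forall>x\<in>pverts G. \<forall>y\<in>pverts G. \<exists>l. walk_in (parcs G) (pverts G) l x y)"
proof -
  have "with_proj G \<restriction> pverts G = with_proj G"
    using pair_wf_digraph.arc_fst_in_verts[OF assms(2)] pair_wf_digraph.arc_snd_in_verts[OF assms(2)]
    by (auto simp: induce_subgraph_def with_proj_def)
  then show ?thesis using connected_induce_iff_walk_in[OF assms(1), of "pverts G"] by simp
qed

section \<open>Containment of pans and diamonds as embeddings\<close>

lemma contains_induced_iff_embedding:
  assumes "pair_wf_digraph H"
  shows "contains_induced G H \<longleftrightarrow> (\<exists>f. inj_on f (pverts H) \<and> f ` pverts H \<subseteq> pverts G \<and>
    (\<forall>i\<in>pverts H. \<forall>j\<in>pverts H. (f i, f j) \<in> parcs G \<longleftrightarrow> (i, j) \<in> parcs H))"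
    (is "?L \<longleftrightarrow> ?R")
proof
  assume ?L
  then obtain S h where S: "S \<subseteq> pverts G"
    and iso: "pre_digraph.digraph_isomorphism (with_proj H) h"
    and eq: "with_proj G \<restriction> S = app_iso h (with_proj H)"
    unfolding contains_induced_def digraph_iso_def by blast
  let ?f = "iso_verts h"
  have SV: "S = ?f ` pverts H" using arg_cong[OF eq, of verts] by (simp add: app_iso_def)
  have "fst = iso_tail h" "snd = iso_head h"
    using arg_cong[OF eq, of tail] arg_cong[OF eq, of head] by (simp_all add: app_iso_def)
  moreover have arcs: "{e \<in> parcs G. fst e \<in> S \<and> snd e \<in> S} = iso_arcs h ` parcs H"
    using arg_cong[OF eq, of arcs] by (simp add: app_iso_def)
  \<comment> \<open>Arcs of \<open>G\<close> are pairs of vertices, so the vertex map determines the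
    arc map.\<close>
  ultimately have ends: "iso_arcs h a = (?f (fst a), ?f (snd a))" if "a \<in> parcs H" for a
    using iso that by (auto simp: pre_digraph.digraph_isomorphism_def prod_eq_iff)
  have inj: "inj_on ?f (pverts H)" using iso by (auto simp: pre_digraph.digraph_isomorphism_def)
  have "(?f i, ?f j) \<in> parcs G \<longleftrightarrow> (i, j) \<in> parcs H" if ij: "i \<in> pverts H" "j \<in> pverts H" for i j
  proof
    assume "(?f i, ?f j) \<in> parcs G"
    then have "(?f i, ?f j) \<in> iso_arcs h ` parcs H" using arcs ij SV by auto
    then obtain a where a: "a \<in> parcs H" "(?f i, ?f j) = (?f (fst a), ?f (snd a))" using ends by auto
    then have "i = fst a" "j = snd a"
      using ij inj pair_wf_digraph.arc_fst_in_verts[OF assms] pair_wf_digraph.arc_snd_in_verts[OF assms]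
      by (auto simp: inj_on_def)
    with a show "(i, j) \<in> parcs H" by simp
  next
    assume "(i, j) \<in> parcs H"
    then have "(?f i, ?f j) \<in> iso_arcs h ` parcs H" using ends by force
    then show "(?f i, ?f j) \<in> parcs G" using arcs by blast
  qed
  with inj S SV show ?R by blast
next
  assume ?R
  then obtain f where f: "inj_on f (pverts H)" "f ` pverts H \<subseteq> pverts G"
    "\<And>i j. i \<in> pverts H \<Longrightarrow> j \<in> pverts H \<Longrightarrow> (f i, f j) \<in> parcs G \<longleftrightarrow> (i, j) \<in> parcs H" by blast
  interpret H: pair_wf_digraph H by fact
  have wf: "fst e \<in> pverts H" "snd e \<in> pverts H" if "e \<in> parcs H" for e
    using that H.arc_fst_in_verts H.arc_snd_in_verts by auto
  define h where "h = \<lparr> iso_verts = f, iso_arcs = map_prod f f, iso_head = snd, iso_tail = fst \<rparr>"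
  have "inj_on (map_prod f f) (parcs H)"
    using f(1) wf by (auto simp: inj_on_def prod_eq_iff)
  then have "pre_digraph.digraph_isomorphism (with_proj H) h"
    unfolding pre_digraph.digraph_isomorphism_def using f(1) H.wf_digraph_axioms by (simp add: h_def)
  moreover have "with_proj G \<restriction> (f ` pverts H) = app_iso h (with_proj H)"
  proof -
    have "{e \<in> parcs G. fst e \<in> f ` pverts H \<and> snd e \<in> f ` pverts H} = map_prod f f ` parcs H"
    proof (intro equalityI subsetI)
      fix e assume "e \<in> {e \<in> parcs G. fst e \<in> f ` pverts H \<and> snd e \<in> f ` pverts H}"
      then obtain i j where ij: "i \<in> pverts H" "j \<in> pverts H" "fst e = f i" "snd e = f j"
        and "e \<in> parcs G" by blast
      then have e: "e = map_prod f f (i, j)" by (simp add: prod_eq_iff)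
      then have "(i, j) \<in> parcs H" using f(3) ij \<open>e \<in> parcs G\<close> by simp
      with e show "e \<in> map_prod f f ` parcs H" by (rule image_eqI)
    next
      fix e assume "e \<in> map_prod f f ` parcs H"
      then obtain a where a: "e = map_prod f f a" "a \<in> parcs H" by (rule imageE)
      then show "e \<in> {e \<in> parcs G. fst e \<in> f ` pverts H \<and> snd e \<in> f ` pverts H}"
        using f(3)[of "fst a" "snd a"] wf[of a] by (cases a) auto
    qed
    then show ?thesis by (simp add: induce_subgraph_def app_iso_def h_def)
  qed
  ultimately show ?L unfolding contains_induced_def digraph_iso_def using f(2) by blast
qed

lemma contains_induced_pan_iff:
  assumes "pair_graph G" "3 \<le> k"
  shows "contains_induced G (pan k) \<longleftrightarrow> (\<exists>c w. induced_pan (parcs G) k c w)"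
proof -
  interpret pair_graph G by fact
  have sm: "(x, y) \<in> parcs G \<Longrightarrow> (y, x) \<in> parcs G" for x y using arcs_symmetric by blast
  have ir: "(x, x) \<notin> parcs G" for x using pair_no_loops by fastforce
  have V: "pverts (pan k) = {0..k}" by (simp add: pan_def)
  have A: "(i, j) \<in> parcs (pan k) \<longleftrightarrow> (i < k \<and> j < k \<and> (j = (i + 1) mod k \<or> i = (j + 1) mod k))
     \<or> (i = 0 \<and> j = k) \<or> (i = k \<and> j = 0)" for i j
    by (auto simp: pan_def)
  have wf: "pair_wf_digraph (pan k)"
    using assms(2) by unfold_locales (auto simp: pan_def)
  show ?thesis unfolding contains_induced_iff_embedding[OF wf] V
  proof
    assume "\<exists>f. inj_on f {0..k} \<and> f ` {0..k} \<subseteq> pverts G \<and>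
      (\<forall>i\<in>{0..k}. \<forall>j\<in>{0..k}. (f i, f j) \<in> parcs G \<longleftrightarrow> (i, j) \<in> parcs (pan k))"
    then obtain f where f: "inj_on f {0..k}"
      "\<And>i j. i \<le> k \<Longrightarrow> j \<le> k \<Longrightarrow> (f i, f j) \<in> parcs G \<longleftrightarrow> (i, j) \<in> parcs (pan k)" by auto
    have "induced_pan (parcs G) k f (f k)"
      unfolding induced_pan_def induced_cycle_def
    proof (intro conjI allI impI)
      show "inj_on f {..<k}" using f(1) by (rule inj_on_subset) auto
      show "f k \<notin> f ` {..<k}"
      proof
        assume "f k \<in> f ` {..<k}"
        then obtain i where "i < k" "f k = f i" by auto
        then show False using inj_onD[OF f(1), of k i] by simp
      qed
    qed (use assms(2) f(2) A in auto)
    then show "\<exists>c w. induced_pan (parcs G) k c w" by blast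
  next
    assume "\<exists>c w. induced_pan (parcs G) k c w"
    then obtain c w where c: "inj_on c {..<k}" "w \<notin> c ` {..<k}"
      "\<And>i j. i < k \<Longrightarrow> j < k \<Longrightarrow> (c i, c j) \<in> parcs G \<longleftrightarrow> (j = (i + 1) mod k \<or> i = (j + 1) mod k)"
      "\<And>i. i < k \<Longrightarrow> (c i, w) \<in> parcs G \<longleftrightarrow> i = 0"
      unfolding induced_pan_def induced_cycle_def by blast
    define f where "f i = (if i < k then c i else w)" for i
    have "inj_on f {0..k}"
      using c(1,2) by (auto simp: inj_on_def f_def)
    moreover have "f i \<in> pverts G" if "i \<le> k" for i
    proof (cases "i < k")
      case True
      then have "(c i, c ((i + 1) mod k)) \<in> parcs G" using c(3) by simp
      then show ?thesis using True arc_fst_in_verts by (fastforce simp: f_def)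
    next
      case False
      have "(c 0, w) \<in> parcs G" using c(4) assms(2) by simp
      then show ?thesis using False arc_snd_in_verts by (fastforce simp: f_def)
    qed
    moreover have "(w, c i) \<in> parcs G \<longleftrightarrow> i = 0" if "i < k" for i using c(4) sm that by blast
    then have "(f i, f j) \<in> parcs G \<longleftrightarrow> (i, j) \<in> parcs (pan k)" if "i \<le> k" "j \<le> k" for i j
      unfolding A using that c(3,4) ir assms(2) by (auto simp: f_def)
    ultimately show "\<exists>f. inj_on f {0..k} \<and> f ` {0..k} \<subseteq> pverts G \<and>
      (\<forall>i\<in>{0..k}. \<forall>j\<in>{0..k}. (f i, f j) \<in> parcs G \<longleftrightarrow> (i, j) \<in> parcs (pan k))"
      by (intro exI[of _ f]) auto
  qed
qed

lemma contains_induced_diamond_iff: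
  assumes "pair_graph G"
  shows "contains_induced G diamond \<longleftrightarrow> \<not> no_diamond (parcs G)"
proof -
  interpret pair_graph G by fact
  have sm: "(x, y) \<in> parcs G \<Longrightarrow> (y, x) \<in> parcs G" for x y using arcs_symmetric by blast
  have ir: "(x, x) \<notin> parcs G" for x using pair_no_loops by fastforce
  have V: "pverts diamond = {0, 1, 2, 3}" by (auto simp: diamond_def)
  have A: "(i, j) \<in> parcs diamond \<longleftrightarrow> i \<le> 3 \<and> j \<le> 3 \<and> i \<noteq> j \<and> (i, j) \<noteq> (0, 1) \<and> (i, j) \<noteq> (1, 0)" for i j
    by (auto simp: diamond_def)
  have wf: "pair_wf_digraph diamond"
    by unfold_locales (auto simp: diamond_def)
  show ?thesis unfolding contains_induced_iff_embedding[OF wf] V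
  proof
    assume "\<exists>f. inj_on f {0, 1, 2, 3} \<and> f ` {0, 1, 2, 3} \<subseteq> pverts G \<and>
      (\<forall>i\<in>{0, 1, 2, 3}. \<forall>j\<in>{0, 1, 2, 3}. (f i, f j) \<in> parcs G \<longleftrightarrow> (i, j) \<in> parcs diamond)"
    then obtain f where "inj_on f {0, 1, 2, 3} \<and> f ` {0, 1, 2, 3} \<subseteq> pverts G \<and>
      (\<forall>i\<in>{0, 1, 2, 3}. \<forall>j\<in>{0, 1, 2, 3}. (f i, f j) \<in> parcs G \<longleftrightarrow> (i, j) \<in> parcs diamond)"
      by (rule exE)
    then have f: "inj_on f {0, 1, 2, 3}"
      "\<forall>i\<in>{0, 1, 2, 3}. \<forall>j\<in>{0, 1, 2, 3}. (f i, f j) \<in> parcs G \<longleftrightarrow> (i, j) \<in> parcs diamond"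
      by (rule conjunct1, elim conjE)
    have "f 0 \<noteq> f 1" using f(1) by (auto simp: inj_on_def)
    moreover have "(f 2, f 3) \<in> parcs G" "(f 0, f 2) \<in> parcs G" "(f 0, f 3) \<in> parcs G"
      "(f 1, f 2) \<in> parcs G" "(f 1, f 3) \<in> parcs G" "(f 0, f 1) \<notin> parcs G"
      using f(2) by (auto simp: A)
    ultimately show "\<not> no_diamond (parcs G)" unfolding no_diamond_def by metis
  next
    assume "\<not> no_diamond (parcs G)"
    then obtain x y u v where xy: "(u, v) \<in> parcs G" "(x, u) \<in> parcs G" "(x, v) \<in> parcs G"
      "(y, u) \<in> parcs G" "(y, v) \<in> parcs G" "x \<noteq> y" "(x, y) \<notin> parcs G"
      unfolding no_diamond_def by blast
    then have neq: "u \<noteq> v" "x \<noteq> u" "x \<noteq> v" "y \<noteq> u" "y \<noteq> v" using ir by auto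
    have vs: "x \<in> pverts G" "y \<in> pverts G" "u \<in> pverts G" "v \<in> pverts G"
      using xy arc_fst_in_verts arc_snd_in_verts by fastforce+
    have xy': "(v, u) \<in> parcs G" "(u, x) \<in> parcs G" "(v, x) \<in> parcs G"
      "(u, y) \<in> parcs G" "(v, y) \<in> parcs G" "(y, x) \<notin> parcs G" using xy sm by blast+
    define f where "f i = (if i = 0 then x else if i = (1::nat) then y else if i = 2 then u else v)" for i
    show "\<exists>f. inj_on f {0, 1, 2, 3} \<and> f ` {0, 1, 2, 3} \<subseteq> pverts G \<and>
      (\<forall>i\<in>{0, 1, 2, 3}. \<forall>j\<in>{0, 1, 2, 3}. (f i, f j) \<in> parcs G \<longleftrightarrow> (i, j) \<in> parcs diamond)"
      using xy xy' neq vs ir by (intro exI[of _ f]) (auto simp: f_def A)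
  qed
qed

lemma pan_diamond_free_iff:
  assumes "pair_graph G"
  shows "pan_diamond_free G \<longleftrightarrow> no_diamond (parcs G) \<and> (\<forall>n. no_pan_below (parcs G) n)"
proof -
  have "(\<forall>k\<ge>3. \<not> contains_induced G (pan k)) \<longleftrightarrow> (\<forall>n. no_pan_below (parcs G) n)"
    using contains_induced_pan_iff[OF assms] unfolding no_pan_below_def
    by (metis induced_pan_def lessI)
  then show ?thesis
    unfolding pan_diamond_free_def using contains_induced_diamond_iff[OF assms] by blast
qed

section \<open>Orderings in terms of positions\<close>

lemma nth_in_set_take: "i < j \<Longrightarrow> j \<le> length xs \<Longrightarrow> xs ! i \<in> set (take j xs)"
  by (auto simp: in_set_conv_nth intro!: exI[of _ i])

lemma precedes_nth:
  assumes "distinct \<sigma>" "i < length \<sigma>" "j < length \<sigma>"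
  shows "precedes \<sigma> (\<sigma> ! i) (\<sigma> ! j) \<longleftrightarrow> i < j"
  unfolding precedes_def using assms nth_eq_iff_index_eq[OF assms(1)] by (metis less_trans)

lemma precedesE:
  assumes "precedes \<sigma> x y"
  obtains i j where "i < j" "j < length \<sigma>" "x = \<sigma> ! i" "y = \<sigma> ! j"
  using assms unfolding precedes_def by blast

text \<open>In a list without repetitions the two occurrences of \<open>b\<close> denote the same
  position. \<open>Q\<close> and \<open>R\<close> are kept abstract so that one proof covers all
  five kinds of ordering.\<close>

lemma all_precedes_iff:
  assumes "distinct \<sigma>"
    and Q: "\<And>i j k. i < j \<Longrightarrow> j < k \<Longrightarrow> k < length \<sigma> \<Longrightarrow> Q (\<sigma> ! i) (\<sigma> ! j) (\<sigma> ! k) \<longleftrightarrow> R i j k"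
  shows "(\<forall>a b c. precedes \<sigma> a b \<and> precedes \<sigma> b c \<and> (a, c) \<in> A \<and> (a, b) \<notin> A \<longrightarrow> Q a b c) \<longleftrightarrow>
    (\<forall>i j k. i < j \<longrightarrow> j < k \<longrightarrow> k < length \<sigma> \<longrightarrow> (\<sigma> ! i, \<sigma> ! k) \<in> A \<longrightarrow> (\<sigma> ! i, \<sigma> ! j) \<notin> A \<longrightarrow>
      R i j k)" (is "?L \<longleftrightarrow> ?R")
proof
  assume L: ?L
  show ?R
  proof (intro allI impI)
    fix i j k assume ijk: "i < j" "j < k" "k < length \<sigma>"
      and A: "(\<sigma> ! i, \<sigma> ! k) \<in> A" "(\<sigma> ! i, \<sigma> ! j) \<notin> A"
    then have "precedes \<sigma> (\<sigma> ! i) (\<sigma> ! j)" "precedes \<sigma> (\<sigma> ! j) (\<sigma> ! k)"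
      using precedes_nth[OF assms(1)] by simp_all
    with A L have "Q (\<sigma> ! i) (\<sigma> ! j) (\<sigma> ! k)" by blast
    then show "R i j k" using Q[OF ijk] by blast
  qed
next
  assume R: ?R
  show ?L
  proof (intro allI impI, elim conjE)
    fix a b c assume ab: "precedes \<sigma> a b" and bc: "precedes \<sigma> b c"
      and A: "(a, c) \<in> A" "(a, b) \<notin> A"
    from ab obtain i j where 1: "i < j" "j < length \<sigma>" "a = \<sigma> ! i" "b = \<sigma> ! j" by (rule precedesE)
    from bc obtain j' k where 2: "j' < k" "k < length \<sigma>" "b = \<sigma> ! j'" "c = \<sigma> ! k" by (rule precedesE)
    have "j' = j" using nth_eq_iff_index_eq[OF assms(1), of j' j] 1 2 by simp
    with 1 2 A R Q show "Q a b c" by blast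
  qed
qed

lemma ex_precedes_iff:
  assumes "distinct \<sigma>" "i < length \<sigma>"
  shows "(\<exists>d. precedes \<sigma> d (\<sigma> ! i) \<and> P d) \<longleftrightarrow> (\<exists>l<i. P (\<sigma> ! l))"
proof
  assume "\<exists>d. precedes \<sigma> d (\<sigma> ! i) \<and> P d"
  then obtain d where d: "precedes \<sigma> d (\<sigma> ! i)" "P d" by blast
  then obtain l j where "l < j" "j < length \<sigma>" "d = \<sigma> ! l" "\<sigma> ! i = \<sigma> ! j" by (meson precedesE)
  then show "\<exists>l<i. P (\<sigma> ! l)" using d nth_eq_iff_index_eq[OF assms(1), of i j] assms(2) by auto
next
  assume "\<exists>l<i. P (\<sigma> ! l)"
  then obtain l where "l < i" "P (\<sigma> ! l)" by blast
  then show "\<exists>d. precedes \<sigma> d (\<sigma> ! i) \<and> P d"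
    using precedes_nth[OF assms(1), of l i] assms(2) by auto
qed

lemma ex_precedes_between_iff:
  assumes "distinct \<sigma>" "i < length \<sigma>" "j < length \<sigma>"
  shows "(\<exists>d. precedes \<sigma> (\<sigma> ! i) d \<and> precedes \<sigma> d (\<sigma> ! j) \<and> P d) \<longleftrightarrow>
    (\<exists>l. i < l \<and> l < j \<and> P (\<sigma> ! l))"
proof -
  have "(\<exists>d. precedes \<sigma> (\<sigma> ! i) d \<and> precedes \<sigma> d (\<sigma> ! j) \<and> P d) \<longleftrightarrow>
      (\<exists>d. precedes \<sigma> d (\<sigma> ! j) \<and> (precedes \<sigma> (\<sigma> ! i) d \<and> P d))" by blast
  also have "\<dots> \<longleftrightarrow> (\<exists>l<j. precedes \<sigma> (\<sigma> ! i) (\<sigma> ! l) \<and> P (\<sigma> ! l))"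
    by (rule ex_precedes_iff) (use assms in auto)
  also have "\<dots> \<longleftrightarrow> (\<exists>l. i < l \<and> l < j \<and> P (\<sigma> ! l))"
    using precedes_nth[OF assms(1,2)] assms(3) less_trans by blast
  finally show ?thesis .
qed

lemma vertex_ordering_distinct: "vertex_ordering G \<sigma> \<Longrightarrow> distinct \<sigma>"
  by (simp add: vertex_ordering_def)

lemma BFS_ordering_iff:
  "BFS_ordering G \<sigma> \<longleftrightarrow> vertex_ordering G \<sigma> \<and> (\<forall>i j k. i < j \<longrightarrow> j < k \<longrightarrow> k < length \<sigma> \<longrightarrow>
    (\<sigma> ! i, \<sigma> ! k) \<in> parcs G \<longrightarrow> (\<sigma> ! i, \<sigma> ! j) \<notin> parcs G \<longrightarrow> (\<exists>l<i. (\<sigma> ! l, \<sigma> ! j) \<in> parcs G))"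
  unfolding BFS_ordering_def
  by (rule conj_cong[OF refl], rule all_precedes_iff)
     (auto simp: vertex_ordering_distinct ex_precedes_iff)

lemma DFS_ordering_iff:
  "DFS_ordering G \<sigma> \<longleftrightarrow> vertex_ordering G \<sigma> \<and> (\<forall>i j k. i < j \<longrightarrow> j < k \<longrightarrow> k < length \<sigma> \<longrightarrow>
    (\<sigma> ! i, \<sigma> ! k) \<in> parcs G \<longrightarrow> (\<sigma> ! i, \<sigma> ! j) \<notin> parcs G \<longrightarrow>
    (\<exists>l. i < l \<and> l < j \<and> (\<sigma> ! l, \<sigma> ! j) \<in> parcs G))"
  unfolding DFS_ordering_def
  by (rule conj_cong[OF refl], rule all_precedes_iff)
     (auto simp: vertex_ordering_distinct ex_precedes_between_iff)

lemma LexBFS_ordering_iff: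
  "LexBFS_ordering G \<sigma> \<longleftrightarrow> vertex_ordering G \<sigma> \<and> (\<forall>i j k. i < j \<longrightarrow> j < k \<longrightarrow> k < length \<sigma> \<longrightarrow>
    (\<sigma> ! i, \<sigma> ! k) \<in> parcs G \<longrightarrow> (\<sigma> ! i, \<sigma> ! j) \<notin> parcs G \<longrightarrow>
    (\<exists>l<i. (\<sigma> ! l, \<sigma> ! j) \<in> parcs G \<and> (\<sigma> ! l, \<sigma> ! k) \<notin> parcs G))"
  unfolding LexBFS_ordering_def
  by (rule conj_cong[OF refl], rule all_precedes_iff)
     (auto simp: vertex_ordering_distinct ex_precedes_iff)

lemma LexDFS_ordering_iff:
  "LexDFS_ordering G \<sigma> \<longleftrightarrow> vertex_ordering G \<sigma> \<and> (\<forall>i j k. i < j \<longrightarrow> j < k \<longrightarrow> k < length \<sigma> \<longrightarrow>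
    (\<sigma> ! i, \<sigma> ! k) \<in> parcs G \<longrightarrow> (\<sigma> ! i, \<sigma> ! j) \<notin> parcs G \<longrightarrow>
    (\<exists>l. i < l \<and> l < j \<and> (\<sigma> ! l, \<sigma> ! j) \<in> parcs G \<and> (\<sigma> ! l, \<sigma> ! k) \<notin> parcs G))"
  unfolding LexDFS_ordering_def
  by (rule conj_cong[OF refl], rule all_precedes_iff)
     (auto simp: vertex_ordering_distinct ex_precedes_between_iff)

lemma MNS_ordering_iff:
  "MNS_ordering G \<sigma> \<longleftrightarrow> vertex_ordering G \<sigma> \<and> (\<forall>i j k. i < j \<longrightarrow> j < k \<longrightarrow> k < length \<sigma> \<longrightarrow>
    (\<sigma> ! i, \<sigma> ! k) \<in> parcs G \<longrightarrow> (\<sigma> ! i, \<sigma> ! j) \<notin> parcs G \<longrightarrow>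
    (\<exists>l<j. (\<sigma> ! l, \<sigma> ! j) \<in> parcs G \<and> (\<sigma> ! l, \<sigma> ! k) \<notin> parcs G))"
  unfolding MNS_ordering_def
  by (rule conj_cong[OF refl], rule all_precedes_iff)
     (auto simp: vertex_ordering_distinct ex_precedes_iff)

text \<open>Among vertex orderings this is the local form of connectedness of all nonempty prefixes;
  see \<open>graph_search_ordering_iff\<close>.\<close>

definition search_order :: "('a \<times> 'a) set \<Rightarrow> 'a list \<Rightarrow> bool" where
  "search_order E \<sigma> \<longleftrightarrow> (\<forall>j. 0 < j \<and> j < length \<sigma> \<longrightarrow> (\<exists>i<j. (\<sigma> ! i, \<sigma> ! j) \<in> E))"

text \<open>Following earlier neighbours leads from either vertex to the first one without leaving
  the prefix.\<close>

lemma search_order_walk_in: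
  assumes E: "sym E" and so: "search_order E \<sigma>" and n: "n \<le> length \<sigma>" "i < n" "j < n"
  shows "\<exists>l. walk_in E (set (take n \<sigma>)) l (\<sigma> ! i) (\<sigma> ! j)"
proof -
  have mem: "\<sigma> ! i \<in> set (take n \<sigma>)" if "i < n" for i
    using that n(1) by (auto simp: in_set_conv_nth)
  have root: "\<exists>l. walk_in E (set (take n \<sigma>)) l (\<sigma> ! i) (\<sigma> ! 0)" if "i < n" for i
    using that
  proof (induction i rule: less_induct)
    case (less i)
    show ?case
    proof (cases "i = 0")
      case True
      then show ?thesis using mem[of 0] less.prems by (intro exI[of _ 0]) simp
    next
      case False
      then obtain h where h: "h < i" "(\<sigma> ! h, \<sigma> ! i) \<in> E"
        using so n(1) less.prems unfolding search_order_def by auto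
      then obtain l where "walk_in E (set (take n \<sigma>)) l (\<sigma> ! h) (\<sigma> ! 0)"
        using less by auto
      then have "walk_in E (set (take n \<sigma>)) (Suc l) (\<sigma> ! i) (\<sigma> ! 0)"
        using h E mem[OF less.prems] by (auto dest: symD)
      then show ?thesis by blast
    qed
  qed
  from root[OF n(2)] root[OF n(3)] show ?thesis
    using walk_in_append walk_in_rev[OF E] by metis
qed

lemma walk_in_leaves:
  "walk_in E V l x y \<Longrightarrow> x \<in> X \<Longrightarrow> y \<notin> X \<Longrightarrow> \<exists>u\<in>X. \<exists>v\<in>V - X. (u, v) \<in> E"
proof (induction l arbitrary: x)
  case (Suc l)
  then obtain z where z: "(x, z) \<in> E" "walk_in E V l z y" by auto
  show ?case
  proof (cases "z \<in> X")
    case True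
    with Suc z show ?thesis by blast
  next
    case False
    with z Suc.prems walk_in_start[OF z(2)] show ?thesis by blast
  qed
qed auto

section \<open>Searches of a connected graph\<close>

locale connected_pair_graph = pair_graph +
  assumes connected: "connected (with_proj G)"
begin

abbreviation E where "E \<equiv> parcs G"
abbreviation V where "V \<equiv> pverts G"

lemma sym_E: "sym E"
  using arcs_symmetric by (auto intro: symI)

lemma irrefl_E: "irrefl E"
  using pair_no_loops by (fastforce simp: irrefl_def)

lemma edge_sym: "(x, y) \<in> E \<longleftrightarrow> (y, x) \<in> E"
  using sym_E by (auto dest: symD)

lemma no_loop: "(x, x) \<notin> E"
  using irrefl_E by (auto simp: irrefl_def)

lemma edge_verts: "(x, y) \<in> E \<Longrightarrow> x \<in> V \<and> y \<in> V"
  using arc_fst_in_verts arc_snd_in_verts by fastforce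

lemma crossing_edge:
  assumes "X \<inter> V \<noteq> {}" "\<not> V \<subseteq> X"
  shows "\<exists>u\<in>X. \<exists>v\<in>V - X. (u, v) \<in> E"
proof -
  obtain x y where xy: "x \<in> X" "x \<in> V" "y \<in> V" "y \<notin> X" using assms by blast
  have "\<forall>x\<in>V. \<forall>y\<in>V. \<exists>l. walk_in E V l x y"
    using connected connected_iff_walk_in[OF sym_E pair_wf_digraph_axioms] by (rule iffD1[THEN conjunct2, rotated])
  then obtain l where "walk_in E V l x y" using xy(2,3) by blast
  then show ?thesis using xy(1,4) by (rule walk_in_leaves)
qed

lemma graph_search_ordering_iff:
  "graph_search_ordering G \<sigma> \<longleftrightarrow> vertex_ordering G \<sigma> \<and> search_order E \<sigma>"
proof
  assume L: "graph_search_ordering G \<sigma>"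
  have "search_order E \<sigma>" unfolding search_order_def
  proof (intro allI impI, elim conjE)
    fix j assume j: "0 < j" "j < length \<sigma>"
    define S where "S = set (take (Suc j) \<sigma>)"
    have "connected (with_proj G \<restriction> S)"
      using L j unfolding graph_search_ordering_def S_def by simp
    moreover have "\<sigma> ! 0 \<in> S" "\<sigma> ! j \<in> S"
      using j by (force simp: in_set_conv_nth S_def)+
    ultimately obtain l where l: "walk_in E S l (\<sigma> ! j) (\<sigma> ! 0)"
      unfolding connected_induce_iff_walk_in[OF sym_E] by blast
    have "\<sigma> \<noteq> []" using j by auto
    then have "\<sigma> ! j \<noteq> \<sigma> ! 0"
      using L j nth_eq_iff_index_eq[of \<sigma> j 0]
      by (simp add: graph_search_ordering_def vertex_ordering_def)
    \<comment> \<open>The first step of a walk to the root inside the prefix ends at a neighbour of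
      position \<open>j\<close> in that prefix.\<close>
    then obtain z where z: "(\<sigma> ! j, z) \<in> E" "z \<in> S"
      using l by (cases l) (auto dest: walk_in_start)
    then obtain i where "i \<le> j" "z = \<sigma> ! i"
      using j by (auto simp: S_def in_set_conv_nth less_Suc_eq_le)
    moreover have "z \<noteq> \<sigma> ! j" using z no_loop by auto
    ultimately show "\<exists>i<j. (\<sigma> ! i, \<sigma> ! j) \<in> E"
      using z edge_sym by (intro exI[of _ i]) (auto simp: le_less)
  qed
  with L show "vertex_ordering G \<sigma> \<and> search_order E \<sigma>"
    by (auto simp: graph_search_ordering_def)
next
  assume R: "vertex_ordering G \<sigma> \<and> search_order E \<sigma>"
  have "connected (with_proj G \<restriction> set (take k \<sigma>))" if k: "1 \<le> k" "k \<le> length \<sigma>" for k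
    unfolding connected_induce_iff_walk_in[OF sym_E]
  proof (intro conjI ballI)
    show "set (take k \<sigma>) \<noteq> {}" using k by auto
    fix x y assume "x \<in> set (take k \<sigma>)" "y \<in> set (take k \<sigma>)"
    then obtain i j where "i < k" "j < k" "x = \<sigma> ! i" "y = \<sigma> ! j"
      using k by (auto simp: in_set_conv_nth)
    then show "\<exists>l. walk_in E (set (take k \<sigma>)) l x y"
      using search_order_walk_in[OF sym_E] R k by auto
  qed
  with R show "graph_search_ordering G \<sigma>" unfolding graph_search_ordering_def by blast
qed

text \<open>By connectedness some edge leaves the prefix before \<open>j\<close>, from position
  \<open>i\<close> to a position \<open>k\<close> with \<open>j \<le> k\<close>. Either
  \<open>k = j\<close>, or \<open>i\<close> itself is adjacent to \<open>j\<close>, or the condition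
  on \<open>i\<close>, \<open>j\<close>, \<open>k\<close> supplies an earlier neighbour of
  \<open>j\<close>.\<close>

lemma search_orderI:
  assumes vo: "vertex_ordering G \<sigma>"
    and cond: "\<And>i j k. i < j \<Longrightarrow> j < k \<Longrightarrow> k < length \<sigma> \<Longrightarrow> (\<sigma> ! i, \<sigma> ! k) \<in> E \<Longrightarrow>
      (\<sigma> ! i, \<sigma> ! j) \<notin> E \<Longrightarrow> \<exists>l<j. (\<sigma> ! l, \<sigma> ! j) \<in> E"
  shows "search_order E \<sigma>"
  unfolding search_order_def
proof (intro allI impI, elim conjE)
  fix j assume j: "0 < j" "j < length \<sigma>"
  have d: "distinct \<sigma>" "set \<sigma> = V" using vo by (auto simp: vertex_ordering_def)
  let ?X = "set (take j \<sigma>)"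
  have "\<sigma> ! 0 \<in> ?X" using j by (force simp: in_set_conv_nth)
  moreover have "\<sigma> ! j \<notin> ?X"
    using j nth_eq_iff_index_eq[OF d(1)] by (auto simp: in_set_conv_nth)
  moreover have "\<sigma> \<noteq> []" using j by auto
  then have "\<sigma> ! 0 \<in> V" "\<sigma> ! j \<in> V"
    using j d(2) nth_mem[of 0 \<sigma>] nth_mem[of j \<sigma>] by simp_all
  ultimately obtain u v where uv: "u \<in> ?X" "v \<in> V - ?X" "(u, v) \<in> E"
    using crossing_edge[of ?X] by blast
  obtain i where i: "i < j" "u = \<sigma> ! i" using uv(1) j by (auto simp: in_set_conv_nth)
  obtain k where k: "k < length \<sigma>" "v = \<sigma> ! k" using uv(2) d(2) by (metis DiffD1 in_set_conv_nth)
  have kj: "j \<le> k"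
  proof (rule ccontr)
    assume "\<not> j \<le> k"
    then have "v \<in> ?X" using k j by (simp add: nth_in_set_take)
    with uv(2) show False by blast
  qed
  show "\<exists>i<j. (\<sigma> ! i, \<sigma> ! j) \<in> E"
  proof (cases "k = j \<or> (\<sigma> ! i, \<sigma> ! j) \<in> E")
    case True
    then show ?thesis using i k uv by auto
  next
    case False
    then show ?thesis using cond[of i j k] i k kj uv by auto
  qed
qed

lemma BFS_search_order:
  assumes "BFS_ordering G \<sigma>"
  shows "search_order E \<sigma>"
proof (rule search_orderI)
  show "vertex_ordering G \<sigma>" using assms by (simp add: BFS_ordering_def)
  fix i j k
  assume ijk: "i < j" "j < k" "k < length \<sigma>" "(\<sigma> ! i, \<sigma> ! k) \<in> E" "(\<sigma> ! i, \<sigma> ! j) \<notin> E"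
  then obtain l where "l < i" "(\<sigma> ! l, \<sigma> ! j) \<in> E"
    using assms unfolding BFS_ordering_iff by blast
  then show "\<exists>l<j. (\<sigma> ! l, \<sigma> ! j) \<in> E" using ijk(1) by (intro exI[of _ l]) simp
qed

lemma DFS_search_order:
  assumes "DFS_ordering G \<sigma>"
  shows "search_order E \<sigma>"
proof (rule search_orderI)
  show "vertex_ordering G \<sigma>" using assms by (simp add: DFS_ordering_def)
  fix i j k
  assume ijk: "i < j" "j < k" "k < length \<sigma>" "(\<sigma> ! i, \<sigma> ! k) \<in> E" "(\<sigma> ! i, \<sigma> ! j) \<notin> E"
  then obtain l where "i < l" "l < j" "(\<sigma> ! l, \<sigma> ! j) \<in> E"
    using assms unfolding DFS_ordering_iff by blast
  then show "\<exists>l<j. (\<sigma> ! l, \<sigma> ! j) \<in> E" using ijk(1) by (intro exI[of _ l]) simp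
qed

section \<open>Pan- and diamond-free graphs: every search is lexicographic\<close>

lemma earlier_neighbour_distinguishes:
  assumes nd: "no_diamond E" and np: "\<And>n. no_pan_below E n"
    and d: "distinct \<sigma>" and so: "search_order E \<sigma>"
    and ord: "i < j" "j < k" "k < length \<sigma>" "l < j"
    and ik: "(\<sigma> ! i, \<sigma> ! k) \<in> E" and ij: "(\<sigma> ! i, \<sigma> ! j) \<notin> E" and lj: "(\<sigma> ! l, \<sigma> ! j) \<in> E"
  shows "(\<sigma> ! l, \<sigma> ! k) \<notin> E"
proof
  assume lk: "(\<sigma> ! l, \<sigma> ! k) \<in> E"
  obtain m where m: "walk_in E (set (take j \<sigma>)) m (\<sigma> ! i) (\<sigma> ! l)"
    using search_order_walk_in[OF sym_E so, of j i l] ord by auto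
  \<comment> \<open>The prefix before \<open>j\<close> contains neither of the two later vertices,
    so its connecting walk avoids them. In \<open>closed_walk_pendant_adjacent\<close> the vertices
    at \<open>i\<close>, \<open>k\<close>, \<open>l\<close>, \<open>j\<close> play \<open>a\<close>,
    \<open>c\<close>, \<open>d\<close>, \<open>b\<close>.\<close>
  have "set (take j \<sigma>) \<subseteq> - {\<sigma> ! j, \<sigma> ! k}"
    using ord nth_eq_iff_index_eq[OF d] by (auto simp: in_set_conv_nth)
  then have "walk_in E (- {\<sigma> ! j, \<sigma> ! k}) m (\<sigma> ! i) (\<sigma> ! l)" using walk_in_mono m by metis
  moreover have "\<sigma> ! i \<noteq> \<sigma> ! l" using ij lj by auto
  moreover have "\<sigma> ! j \<noteq> \<sigma> ! k" using ord nth_eq_iff_index_eq[OF d, of j k] by simp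
  moreover have "(\<sigma> ! k, \<sigma> ! l) \<in> E" using lk edge_sym by blast
  ultimately have "(\<sigma> ! i, \<sigma> ! j) \<in> E"
    using closed_walk_pendant_adjacent[OF sym_E irrefl_E nd np, where n = "m + 3"] ik lj by simp
  with ij show False ..
qed

text \<open>The witness of the plain condition also serves the lexicographic one: by
  \<open>dist\<close> it is not adjacent to \<open>c\<close>, and its position is unchanged. For a
  graph search any earlier neighbour of \<open>b\<close> is taken.\<close>

lemma pan_diamond_free_imp_lex:
  assumes "pan_diamond_free G"
  shows "DFS_ordering G \<sigma> \<Longrightarrow> LexDFS_ordering G \<sigma>"
    and "BFS_ordering G \<sigma> \<Longrightarrow> LexBFS_ordering G \<sigma>"
    and "graph_search_ordering G \<sigma> \<Longrightarrow> MNS_ordering G \<sigma>"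
proof -
  have nd: "no_diamond E" and np: "\<And>n. no_pan_below E n"
    using assms pan_diamond_free_iff[OF pair_graph_axioms] by auto
  note dist = earlier_neighbour_distinguishes[OF nd np vertex_ordering_distinct, of G \<sigma>]
  show "LexDFS_ordering G \<sigma>" if s: "DFS_ordering G \<sigma>"
  proof -
    have vo: "vertex_ordering G \<sigma>" using s by (simp add: DFS_ordering_def)
    show ?thesis unfolding LexDFS_ordering_iff
    proof (intro conjI allI impI)
      fix i j k assume *: "i < j" "j < k" "k < length \<sigma>" "(\<sigma> ! i, \<sigma> ! k) \<in> E" "(\<sigma> ! i, \<sigma> ! j) \<notin> E"
      then obtain l where l: "i < l" "l < j" "(\<sigma> ! l, \<sigma> ! j) \<in> E"
        using s unfolding DFS_ordering_iff by blast
      with dist[OF vo DFS_search_order[OF s] *(1-3) l(2) *(4,5) l(3)]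
      show "\<exists>l. i < l \<and> l < j \<and> (\<sigma> ! l, \<sigma> ! j) \<in> E \<and> (\<sigma> ! l, \<sigma> ! k) \<notin> E" by blast
    qed (fact vo)
  qed
  show "LexBFS_ordering G \<sigma>" if s: "BFS_ordering G \<sigma>"
  proof -
    have vo: "vertex_ordering G \<sigma>" using s by (simp add: BFS_ordering_def)
    show ?thesis unfolding LexBFS_ordering_iff
    proof (intro conjI allI impI)
      fix i j k assume *: "i < j" "j < k" "k < length \<sigma>" "(\<sigma> ! i, \<sigma> ! k) \<in> E" "(\<sigma> ! i, \<sigma> ! j) \<notin> E"
      then obtain l where l: "l < i" "(\<sigma> ! l, \<sigma> ! j) \<in> E"
        using s unfolding BFS_ordering_iff by blast
      with dist[OF vo BFS_search_order[OF s] *(1-3) less_trans[OF l(1) *(1)] *(4,5) l(2)]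
      show "\<exists>l<i. (\<sigma> ! l, \<sigma> ! j) \<in> E \<and> (\<sigma> ! l, \<sigma> ! k) \<notin> E" by blast
    qed (fact vo)
  qed
  show "MNS_ordering G \<sigma>" if s: "graph_search_ordering G \<sigma>"
  proof -
    have vo: "vertex_ordering G \<sigma>" and so: "search_order E \<sigma>"
      using s by (auto simp: graph_search_ordering_iff)
    show ?thesis unfolding MNS_ordering_iff
    proof (intro conjI allI impI)
      fix i j k assume *: "i < j" "j < k" "k < length \<sigma>" "(\<sigma> ! i, \<sigma> ! k) \<in> E" "(\<sigma> ! i, \<sigma> ! j) \<notin> E"
      then obtain l where l: "l < j" "(\<sigma> ! l, \<sigma> ! j) \<in> E"
        using so unfolding search_order_def by (metis gr_zeroI less_trans not_less_zero)
      with dist[OF vo so *(1-3) l(1) *(4,5) l(2)]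
      show "\<exists>l<j. (\<sigma> ! l, \<sigma> ! j) \<in> E \<and> (\<sigma> ! l, \<sigma> ! k) \<notin> E" by blast
    qed (fact vo)
  qed
qed

end

section \<open>Greedy construction of orderings\<close>

text \<open>Legality is recorded choice by choice, so that a prescribed legal beginning can be
  completed to an ordering of all vertices; this is how bad orderings are forced.\<close>

definition built :: "('a list \<Rightarrow> 'a \<Rightarrow> bool) \<Rightarrow> 'a list \<Rightarrow> bool" where
  "built step xs \<longleftrightarrow> (\<forall>j<length xs. step (take j xs) (xs ! j))"

lemma built_snoc: "built step (xs @ [y]) \<longleftrightarrow> built step xs \<and> step xs y"
  unfolding built_def by (auto simp: less_Suc_eq nth_append)

lemma built_append:
  assumes "built step (xs @ ys)"
  shows "built step xs"
  unfolding built_def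
proof (intro allI impI)
  fix j assume j: "j < length xs"
  then have "j < length (xs @ ys)" by simp
  with assms have "step (take j (xs @ ys)) ((xs @ ys) ! j)" unfolding built_def by blast
  then show "step (take j xs) (xs ! j)" using j by (simp add: nth_append)
qed

lemma built_distinct:
  assumes "built step xs" "\<And>xs y. step xs y \<Longrightarrow> y \<in> V - set xs"
  shows "distinct xs \<and> set xs \<subseteq> V"
  using assms(1) by (induction xs rule: rev_induct) (auto simp: built_snoc dest: assms(2))

lemma built_extend:
  assumes V: "finite V" and new: "\<And>xs y. step xs y \<Longrightarrow> y \<in> V - set xs"
    and ex: "\<And>xs. xs \<noteq> [] \<Longrightarrow> set xs \<subset> V \<Longrightarrow> \<exists>y. step xs y"
  shows "built step xs \<Longrightarrow> xs \<noteq> [] \<Longrightarrow> \<exists>ys. built step (xs @ ys) \<and> set (xs @ ys) = V"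
proof (induction "card (V - set xs)" arbitrary: xs rule: less_induct)
  case less
  have sub: "set xs \<subseteq> V" using built_distinct[OF less.prems(1) new] by blast
  show ?case
  proof (cases "set xs = V")
    case True
    then show ?thesis using less.prems by (intro exI[of _ "[]"]) simp
  next
    case False
    then obtain y where y: "step xs y" using ex less.prems sub by blast
    then have "y \<in> V - set xs" by (rule new)
    then have "card (V - set (xs @ [y])) < card (V - set xs)"
      using V by (intro psubset_card_mono) auto
    moreover have "built step (xs @ [y])" using less.prems y by (simp add: built_snoc)
    ultimately obtain ys where "built step ((xs @ [y]) @ ys)" "set ((xs @ [y]) @ ys) = V"
      using less.hyps[of "xs @ [y]"] by auto
    then show ?thesis by (intro exI[of _ "y # ys"]) simp
  qed
qed

context connected_pair_graph
begin

text \<open>The DFS condition with \<open>y\<close> as \<open>b\<close>: the vertices that may still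
  follow \<open>y\<close>, and hence play \<open>c\<close>, are among the unvisited ones.
  \<open>bfs_step\<close> is formed likewise.\<close>

definition dfs_step :: "'a list \<Rightarrow> 'a \<Rightarrow> bool" where
  "dfs_step xs y \<longleftrightarrow> y \<in> V - set xs \<and> (\<forall>i<length xs. \<forall>c\<in>V - set xs. (xs ! i, c) \<in> E \<longrightarrow>
     (xs ! i, y) \<notin> E \<longrightarrow> (\<exists>l. i < l \<and> l < length xs \<and> (xs ! l, y) \<in> E))"

definition bfs_step :: "'a list \<Rightarrow> 'a \<Rightarrow> bool" where
  "bfs_step xs y \<longleftrightarrow> y \<in> V - set xs \<and> (\<forall>i<length xs. \<forall>c\<in>V - set xs. (xs ! i, c) \<in> E \<longrightarrow>
     (xs ! i, y) \<notin> E \<longrightarrow> (\<exists>l<i. (xs ! l, y) \<in> E))"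

lemma ex_unvisited_neighbour:
  assumes "xs \<noteq> []" "set xs \<subset> V"
  shows "\<exists>i<length xs. \<exists>c\<in>V - set xs. (xs ! i, c) \<in> E"
proof -
  have "set xs \<inter> V \<noteq> {}" using assms by (cases xs) auto
  moreover have "\<not> V \<subseteq> set xs" using assms by blast
  ultimately show ?thesis
    using crossing_edge[of "set xs"] by (metis in_set_conv_nth)
qed

lemma dfs_step_exists:
  assumes "xs \<noteq> []" "set xs \<subset> V"
  shows "\<exists>y. dfs_step xs y"
proof -
  let ?P = "\<lambda>i. i < length xs \<and> (\<exists>c\<in>V - set xs. (xs ! i, c) \<in> E)"
  have ex: "\<exists>i. ?P i" using ex_unvisited_neighbour[OF assms] by blast
  \<comment> \<open>Any unvisited neighbour of the most recent vertex that still has one is a legal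
    choice.\<close>
  define m where "m = (GREATEST i. ?P i)"
  have m: "?P m" unfolding m_def
    by (rule GreatestI_ex_nat[where P = ?P and b = "length xs", OF ex]) simp
  have "i \<le> m" if "?P i" for i unfolding m_def
    by (rule Greatest_le_nat[where P = ?P and b = "length xs", OF that]) simp
  moreover obtain y where y: "y \<in> V - set xs" "(xs ! m, y) \<in> E" using m by blast
  ultimately have "dfs_step xs y"
    unfolding dfs_step_def using m le_neq_implies_less by blast
  then show ?thesis ..
qed

text \<open>Visited vertices before \<open>i\<close> have no unvisited neighbour; for those after
  \<open>i\<close>, the vertex \<open>xs ! i\<close> is the required earlier neighbour of
  \<open>y\<close>.\<close>

lemma bfs_stepI:
  assumes "i < length xs" "y \<in> V - set xs" "(xs ! i, y) \<in> E"
    and "\<And>l c. l < i \<Longrightarrow> c \<in> V - set xs \<Longrightarrow> (xs ! l, c) \<notin> E"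
  shows "bfs_step xs y"
  unfolding bfs_step_def using assms by (metis linorder_neqE_nat)

lemma bfs_step_exists:
  assumes "xs \<noteq> []" "set xs \<subset> V"
  shows "\<exists>y. bfs_step xs y"
proof -
  let ?P = "\<lambda>i. i < length xs \<and> (\<exists>c\<in>V - set xs. (xs ! i, c) \<in> E)"
  have "\<exists>i. ?P i" using ex_unvisited_neighbour[OF assms] by blast
  then obtain m where m: "?P m" "\<And>i. i < m \<Longrightarrow> \<not> ?P i" using exists_least_iff[of ?P] by blast
  then obtain y where "y \<in> V - set xs" "(xs ! m, y) \<in> E" by blast
  then have "bfs_step xs y" using m by (intro bfs_stepI[of m]) (auto dest: less_trans)
  then show ?thesis ..
qed

lemma vertex_ordering_unvisited:
  assumes "vertex_ordering G \<sigma>" "j \<le> k" "k < length \<sigma>"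
  shows "\<sigma> ! k \<in> V - set (take j \<sigma>)"
proof -
  have "\<sigma> ! k \<in> V" using assms nth_mem by (fastforce simp: vertex_ordering_def)
  moreover have "\<sigma> ! k \<notin> set (take j \<sigma>)"
    using assms nth_eq_iff_index_eq[of \<sigma>] by (auto simp: vertex_ordering_def in_set_conv_nth)
  ultimately show ?thesis by blast
qed

lemma built_dfs_imp_DFS_ordering:
  assumes b: "built dfs_step \<sigma>" and "set \<sigma> = V"
  shows "DFS_ordering G \<sigma>"
proof -
  have vo: "vertex_ordering G \<sigma>"
    using assms built_distinct[OF b, of V] by (auto simp: vertex_ordering_def dfs_step_def)
  show ?thesis unfolding DFS_ordering_iff
  proof (intro conjI allI impI)
    fix i j k assume ijk: "i < j" "j < k" "k < length \<sigma>" "(\<sigma> ! i, \<sigma> ! k) \<in> E" "(\<sigma> ! i, \<sigma> ! j) \<notin> E"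
    have "dfs_step (take j \<sigma>) (\<sigma> ! j)" using b ijk unfolding built_def by simp
    moreover have "\<sigma> ! k \<in> V - set (take j \<sigma>)"
      by (rule vertex_ordering_unvisited[OF vo]) (use ijk in auto)
    moreover have "i < length (take j \<sigma>)" "(take j \<sigma> ! i, \<sigma> ! k) \<in> E" "(take j \<sigma> ! i, \<sigma> ! j) \<notin> E"
      using ijk by auto
    ultimately obtain l where "i < l" "l < length (take j \<sigma>)" "(take j \<sigma> ! l, \<sigma> ! j) \<in> E"
      unfolding dfs_step_def by blast
    then show "\<exists>l. i < l \<and> l < j \<and> (\<sigma> ! l, \<sigma> ! j) \<in> E" by auto
  qed (fact vo)
qed

text \<open>The converse direction allows a finished BFS ordering to be cut at some position and
  continued differently.\<close>

lemma built_bfs_iff_BFS_ordering: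
  "built bfs_step \<sigma> \<and> set \<sigma> = V \<longleftrightarrow> BFS_ordering G \<sigma>"
proof
  assume assms: "built bfs_step \<sigma> \<and> set \<sigma> = V"
  have vo: "vertex_ordering G \<sigma>"
    using assms built_distinct[of bfs_step \<sigma> V] by (auto simp: vertex_ordering_def bfs_step_def)
  show "BFS_ordering G \<sigma>" unfolding BFS_ordering_iff
  proof (intro conjI allI impI)
    fix i j k assume ijk: "i < j" "j < k" "k < length \<sigma>" "(\<sigma> ! i, \<sigma> ! k) \<in> E" "(\<sigma> ! i, \<sigma> ! j) \<notin> E"
    have "bfs_step (take j \<sigma>) (\<sigma> ! j)" using assms ijk unfolding built_def by simp
    moreover have "\<sigma> ! k \<in> V - set (take j \<sigma>)"
      by (rule vertex_ordering_unvisited[OF vo]) (use ijk in auto)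
    moreover have "i < length (take j \<sigma>)" "(take j \<sigma> ! i, \<sigma> ! k) \<in> E" "(take j \<sigma> ! i, \<sigma> ! j) \<notin> E"
      using ijk by auto
    ultimately obtain l where "l < i" "(take j \<sigma> ! l, \<sigma> ! j) \<in> E"
      unfolding bfs_step_def by blast
    then show "\<exists>l<i. (\<sigma> ! l, \<sigma> ! j) \<in> E" using ijk by auto
  qed (fact vo)
next
  assume B: "BFS_ordering G \<sigma>"
  then have vo: "vertex_ordering G \<sigma>" by (simp add: BFS_ordering_def)
  have "bfs_step (take j \<sigma>) (\<sigma> ! j)" if j: "j < length \<sigma>" for j
    unfolding bfs_step_def
  proof (intro conjI allI ballI impI)
    show "\<sigma> ! j \<in> V - set (take j \<sigma>)"
      by (rule vertex_ordering_unvisited[OF vo]) (use j in auto)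
    fix i c assume i: "i < length (take j \<sigma>)" and c: "c \<in> V - set (take j \<sigma>)"
      and ic: "(take j \<sigma> ! i, c) \<in> E" and ij: "(take j \<sigma> ! i, \<sigma> ! j) \<notin> E"
    have "c \<in> set \<sigma>" using c vo by (simp add: vertex_ordering_def)
    then obtain k where k: "k < length \<sigma>" "c = \<sigma> ! k" by (metis in_set_conv_nth)
    have "j \<le> k"
    proof (rule ccontr)
      assume "\<not> j \<le> k"
      then have "c \<in> set (take j \<sigma>)" using k j by (simp add: nth_in_set_take)
      with c show False by blast
    qed
    moreover have "k \<noteq> j" using ic ij k by auto
    ultimately have "\<exists>l<i. (\<sigma> ! l, \<sigma> ! j) \<in> E"
      using B i k ic ij j unfolding BFS_ordering_iff by (auto simp: le_less)
    then show "\<exists>l<i. (take j \<sigma> ! l, \<sigma> ! j) \<in> E" using i by auto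
  qed
  then show "built bfs_step \<sigma> \<and> set \<sigma> = V"
    using vo by (simp add: built_def vertex_ordering_def)
qed

lemma built_dfs_extend:
  assumes "built dfs_step xs" "xs \<noteq> []"
  shows "\<exists>ys. DFS_ordering G (xs @ ys)"
proof -
  have "\<exists>ys. built dfs_step (xs @ ys) \<and> set (xs @ ys) = V"
    by (rule built_extend[OF pair_finite_verts _ dfs_step_exists assms]) (simp_all add: dfs_step_def)
  then show ?thesis using built_dfs_imp_DFS_ordering by blast
qed

lemma built_bfs_extend:
  assumes "built bfs_step xs" "xs \<noteq> []"
  shows "\<exists>ys. BFS_ordering G (xs @ ys)"
proof -
  have "\<exists>ys. built bfs_step (xs @ ys) \<and> set (xs @ ys) = V"
    by (rule built_extend[OF pair_finite_verts _ bfs_step_exists assms]) (simp_all add: bfs_step_def)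
  then show ?thesis using built_bfs_iff_BFS_ordering by blast
qed

section \<open>Depth-first orderings that violate LexDFS and MNS\<close>

lemma path_built_dfs:
  assumes "distinct xs" "set xs \<subseteq> V" "\<And>j. Suc j < length xs \<Longrightarrow> (xs ! j, xs ! Suc j) \<in> E"
  shows "built dfs_step xs"
  unfolding built_def
proof (intro allI impI)
  fix j assume j: "j < length xs"
  show "dfs_step (take j xs) (xs ! j)" unfolding dfs_step_def
  proof (intro conjI allI ballI impI)
    show "xs ! j \<in> V - set (take j xs)"
      using subsetD[OF assms(2) nth_mem[OF j]] j nth_eq_iff_index_eq[OF assms(1)]
      by (auto simp: in_set_conv_nth)
    fix i c assume i: "i < length (take j xs)" and ij: "(take j xs ! i, xs ! j) \<notin> E"
    \<comment> \<open>The predecessor on the path is the vertex visited last, so it lies after every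
      other visited position and is the required neighbour of \<open>xs ! j\<close>.\<close>
    then have "(xs ! (j - 1), xs ! j) \<in> E" using assms(3)[of "j - 1"] j by auto
    moreover from this have "i \<noteq> j - 1" using i ij by auto
    ultimately show "\<exists>l. i < l \<and> l < length (take j xs) \<and> (take j xs ! l, xs ! j) \<in> E"
      using i j by (intro exI[of _ "j - 1"]) auto
  qed
qed

text \<open>Every path is a legal beginning of a depth-first search. The triple
  \<open>hd xs\<close>, \<open>last xs\<close>, \<open>c\<close> then violates both conditions,
  since every neighbour of \<open>last xs\<close> visited before it is also a neighbour of
  \<open>c\<close>.\<close>

lemma path_gives_bad_DFS:
  assumes path: "distinct xs" "set xs \<subseteq> V" "\<And>j. Suc j < length xs \<Longrightarrow> (xs ! j, xs ! Suc j) \<in> E"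
    and len: "2 \<le> length xs" and c: "c \<notin> set xs" "(hd xs, c) \<in> E" "(hd xs, last xs) \<notin> E"
    and d: "\<And>d. d \<in> set xs \<Longrightarrow> (d, last xs) \<in> E \<Longrightarrow> (d, c) \<in> E"
  shows "\<exists>\<sigma>. DFS_ordering G \<sigma> \<and> \<not> LexDFS_ordering G \<sigma> \<and> \<not> MNS_ordering G \<sigma>"
proof -
  have ne: "xs \<noteq> []" using len by auto
  obtain ys where s: "DFS_ordering G (xs @ ys)" (is "DFS_ordering G ?s")
    using built_dfs_extend[OF path_built_dfs[OF path] ne] by auto
  define j where "j = length xs - 1"
  have j: "0 < j" "j < length xs" using len by (auto simp: j_def)
  have hd: "?s ! 0 = hd xs" and last: "?s ! j = last xs"
    using ne j by (auto simp: nth_append hd_conv_nth last_conv_nth j_def)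
  have "c \<in> set ?s"
    using s edge_verts[OF c(2)] by (simp add: DFS_ordering_def vertex_ordering_def)
  then obtain k where k: "k < length ?s" "?s ! k = c" by (meson in_set_conv_nth)
  have "length xs \<le> k"
  proof (rule ccontr)
    assume "\<not> length xs \<le> k"
    then have "c \<in> set xs" using k by (auto simp: nth_append)
    with c(1) show False ..
  qed
  then have jk: "j < k" using j by simp
  have all: "(?s ! l, ?s ! k) \<in> E" if "l < j" "(?s ! l, ?s ! j) \<in> E" for l
  proof -
    have "?s ! l \<in> set xs" using that j by (auto simp: nth_append)
    then show ?thesis using d that last k by metis
  qed
  have "(?s ! 0, ?s ! k) \<in> E" "(?s ! 0, ?s ! j) \<notin> E" using hd last k c by simp_all
  then have "\<not> MNS_ordering G ?s" "\<not> LexDFS_ordering G ?s"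
    unfolding MNS_ordering_iff LexDFS_ordering_iff using all j(1) jk k(1) by blast+
  with s show ?thesis by blast
qed

lemma pan_gives_bad_DFS:
  assumes "induced_pan E k c w"
  shows "\<exists>\<sigma>. DFS_ordering G \<sigma> \<and> \<not> LexDFS_ordering G \<sigma> \<and> \<not> MNS_ordering G \<sigma>"
proof -
  have k: "3 \<le> k" and cyc: "induced_cycle E k c" and w: "w \<notin> c ` {..<k}"
    and wE: "\<And>i. i < k \<Longrightarrow> (c i, w) \<in> E \<longleftrightarrow> i = 0"
    using assms unfolding induced_pan_def by auto
  note edge = induced_cycle_edge_iff[OF cyc]
  have inj: "inj_on c {..<k}" using cyc by (simp add: induced_cycle_def)
  \<comment> \<open>The path runs along the cycle from \<open>c (k - 2)\<close> down to
    \<open>c 0\<close> and ends in \<open>w\<close>. The omitted vertex \<open>c (k - 1)\<close> is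
    adjacent to its start and to \<open>c 0\<close>, the only neighbour of \<open>w\<close> on
    it.\<close>
  define xs where "xs = rev (map c [0..<k - 1]) @ [w]"
  have len: "length xs = k" using k by (simp add: xs_def)
  have nth: "xs ! j = (if j < k - 1 then c (k - 2 - j) else w)" if "j < k" for j
    using that k by (auto simp: xs_def nth_append rev_nth numeral_2_eq_2)
  have set: "set xs = insert w (c ` {..<k - 1})" by (auto simp: xs_def)
  have cV: "c i \<in> V" if "i < k" for i
  proof (cases "i = 0")
    case True
    then show ?thesis using wE[of 0] k edge_verts by auto
  next
    case False
    then show ?thesis using edge[of "i - 1" i] that edge_verts by auto
  qed
  show ?thesis
  proof (rule path_gives_bad_DFS[where xs = xs and c = "c (k - 1)"])
    have "inj_on c {0..<k - 1}" using inj by (rule inj_on_subset) auto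
    then show "distinct xs" using w by (auto simp: xs_def distinct_map)
    show "set xs \<subseteq> V" using cV wE[of 0] k edge_verts by (auto simp: set)
    show "(xs ! j, xs ! Suc j) \<in> E" if "Suc j < length xs" for j
    proof (cases "Suc j < k - 1")
      case True
      have "(c (k - 3 - j), c (k - 2 - j)) \<in> E" using edge[of "k - 3 - j" "k - 2 - j"] True by auto
      moreover have "k - 2 - Suc j = k - 3 - j" by simp
      ultimately show ?thesis using True edge_sym by (simp add: nth)
    next
      case False
      then have "j = k - 2" using that len by auto
      then show ?thesis using k wE[of 0] by (auto simp: nth)
    qed
    have ne: "xs \<noteq> []" using len k by auto
    have hd: "hd xs = c (k - 2)" using ne k by (simp add: hd_conv_nth nth)
    have last: "last xs = w" by (simp add: xs_def)
    show "2 \<le> length xs" using len k by simp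
    have "c (k - 1) \<noteq> c i" if "i < k - 1" for i
      using induced_cycle_neq[OF cyc, of "k - 1" i] that by simp
    moreover have "c (k - 1) \<noteq> w" using w k by auto
    ultimately show "c (k - 1) \<notin> set xs" by (auto simp: set)
    show "(hd xs, c (k - 1)) \<in> E" using edge[of "k - 2" "k - 1"] k by (auto simp: hd)
    show "(hd xs, last xs) \<notin> E" using wE[of "k - 2"] k by (auto simp: hd last)
    fix d assume "d \<in> set xs" "(d, last xs) \<in> E"
    then have "d = c 0" using wE no_loop by (auto simp: set last)
    then show "(d, c (k - 1)) \<in> E" using edge[of 0 "k - 1"] k by auto
  qed
qed

lemma diamond_gives_bad_DFS:
  assumes "\<not> no_diamond E"
  shows "\<exists>\<sigma>. DFS_ordering G \<sigma> \<and> \<not> LexDFS_ordering G \<sigma> \<and> \<not> MNS_ordering G \<sigma>"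
proof -
  obtain x y u v where e: "(u, v) \<in> E" "(x, u) \<in> E" "(x, v) \<in> E" "(y, u) \<in> E" "(y, v) \<in> E"
    "x \<noteq> y" "(x, y) \<notin> E"
    using assms unfolding no_diamond_def by blast
  then have neq: "u \<noteq> v" "x \<noteq> u" "x \<noteq> v" "y \<noteq> u" "y \<noteq> v" using no_loop by auto
  have uy: "(u, y) \<in> E" using e edge_sym by blast
  show ?thesis
  \<comment> \<open>The only vertex of the path adjacent to \<open>y\<close> is \<open>u\<close>,
    which is also adjacent to the omitted vertex \<open>v\<close>.\<close>
  proof (rule path_gives_bad_DFS[where xs = "[x, u, y]" and c = v])
    show "([x, u, y] ! j, [x, u, y] ! Suc j) \<in> E" if "Suc j < length [x, u, y]" for j
      using that e uy by (cases j) auto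
  qed (use e neq edge_verts no_loop in auto)
qed

end

section \<open>Isometry of cycles in minimal pans\<close>

text \<open>A shortcut from \<open>c i\<close> to \<open>c 0\<close> and an arc of the cycle form a
  closed walk shorter than \<open>k\<close> with \<open>c (i + 1)\<close> attached at
  \<open>c i\<close>; \<open>closed_walk_pendant_adjacent\<close> then yields a chord of the induced
  cycle.\<close>

lemma induced_cycle_isometric:
  assumes E: "sym E" "irrefl E" and nd: "no_diamond E" and np: "no_pan_below E k"
    and k: "4 \<le> k" and cyc: "induced_cycle E k c"
  shows "walk_in E UNIV L (c i) (c 0) \<Longrightarrow> i < k \<Longrightarrow> min i (k - i) \<le> L"
proof (induction L arbitrary: i rule: less_induct)
  case (less L)
  note walk = less.prems(1) and ik = less.prems(2)
  note edge = induced_cycle_edge_iff[OF cyc] and neq = induced_cycle_neq[OF cyc]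
  show ?case
  proof (rule ccontr)
    assume "\<not> min i (k - i) \<le> L"
    then have short: "L < i" "L < k - i" by auto
    have "L \<noteq> 0" using walk neq[of i 0] short ik by (cases L) auto
    moreover have "L \<noteq> 1"
    proof
      assume "L = 1"
      then have "(c 0, c i) \<in> E" using walk E(1) by (auto dest: symD)
      then show False using edge[of 0 i] short ik \<open>L = 1\<close> by auto
    qed
    ultimately have L: "2 \<le> L" by simp
    obtain p where p: "p 0 = c i" "p L = c 0" "\<forall>t<L. (p t, p (Suc t)) \<in> E"
      using walk unfolding walk_in_iff_fun by blast
    \<comment> \<open>If the walk met a cycle neighbour \<open>c h\<close> of \<open>c i\<close>,
      its remainder would be a walk to \<open>c 0\<close> shorter than \<open>L\<close>, although
      \<open>min h (k - h)\<close> is at least \<open>L\<close>.\<close>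
    have avoid: "p t \<noteq> c h" if "t \<le> L" "h = i + 1 \<or> h = i - 1" for t h
    proof
      assume pt: "p t = c h"
      have h: "h < k" "h \<noteq> i" using that short L by auto
      then have "t \<noteq> 0" using pt p(1) neq[of i h] ik by (cases t) auto
      moreover have "walk_in E UNIV (L - t) (c h) (c 0)"
        using walk_in_segment[OF p(3), of UNIV t L] pt p(2) that by simp
      ultimately have "min h (k - h) \<le> L - t" using less.IH[of "L - t" h] L h by simp
      then show False using that short \<open>t \<noteq> 0\<close> L by auto
    qed
    have w1: "walk_in E (- {c (i + 1), c (i - 1)}) L (c 0) (c i)"
    proof (rule walk_in_rev[OF E(1)])
      show "walk_in E (- {c (i + 1), c (i - 1)}) L (c i) (c 0)"
        unfolding walk_in_iff_fun using p avoid by (intro exI[of _ p]) auto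
    qed
    have w2: "walk_in E (- {c (i + 1), c (i - 1)}) (i - 2) (c (i - 2)) (c 0)"
    proof (rule walk_in_rev[OF E(1)])
      have "(c t, c (Suc t)) \<in> E" if "t < i - 2" for t using edge[of t "Suc t"] that ik by auto
      moreover have "c t \<noteq> c (i + 1) \<and> c t \<noteq> c (i - 1)" if "t \<le> i - 2" for t
        using neq[of t "i + 1"] neq[of t "i - 1"] that short L by auto
      ultimately show "walk_in E (- {c (i + 1), c (i - 1)}) (i - 2) (c 0) (c (i - 2))"
        unfolding walk_in_iff_fun by (intro exI[of _ c]) auto
    qed
    have "(c (i - 2), c (i + 1)) \<in> E"
    proof (rule closed_walk_pendant_adjacent[OF E nd np walk_in_append[OF w2 w1]])
      show "i - 2 + L + 2 < k" using short L by simp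
      show "(c (i - 2), c (i - 1)) \<in> E" "(c (i - 1), c i) \<in> E" "(c i, c (i + 1)) \<in> E"
        using edge[of "i - 2" "i - 1"] edge[of "i - 1" i] edge[of i "i + 1"] short L by auto
      show "c (i - 2) \<noteq> c i" "c (i + 1) \<noteq> c (i - 1)"
        using neq[of "i - 2" i] neq[of "i + 1" "i - 1"] short L by auto
    qed
    \<comment> \<open>Since \<open>L < i\<close> and \<open>2 \<le> L\<close>, the index
      \<open>i - 2\<close> is positive, so \<open>i - 2\<close> and \<open>i + 1\<close> are not
      joined by the wrap-around edge either.\<close>
    moreover have "i - 2 < i + 1" "i + 1 < k" using short L by auto
    ultimately show False using edge[of "i - 2" "i + 1"] short L by auto
  qed
qed

text \<open>Moves the base point, so that isometry, stated for distances to \<open>c 0\<close>,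
  applies to any two cycle vertices.\<close>

lemma induced_cycle_rotate:
  assumes "induced_cycle E k c" "0 < k"
  shows "induced_cycle E k (\<lambda>t. c ((s + t) mod k))"
proof -
  have cancel: "(s + i) mod k = (s + j) mod k \<longleftrightarrow> i mod k = j mod k" for i j
    unfolding nat_mod_eq_iff by simp
  have eq: "(s + i) mod k = ((s + j) mod k + 1) mod k \<longleftrightarrow> i = (j + 1) mod k" if "i < k" for i j
    using cancel[of i "j + 1"] that by (simp add: mod_Suc_eq)
  have "inj_on (\<lambda>t. c ((s + t) mod k)) {..<k}"
  proof (rule inj_onI)
    fix i j assume ij: "i \<in> {..<k}" "j \<in> {..<k}" "c ((s + i) mod k) = c ((s + j) mod k)"
    then have "(s + i) mod k = (s + j) mod k"
      using assms unfolding induced_cycle_def inj_on_def by (metis lessThan_iff mod_less_divisor)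
    then show "i = j" using cancel ij by simp
  qed
  moreover have "(c ((s + i) mod k), c ((s + j) mod k)) \<in> E \<longleftrightarrow> j = (i + 1) mod k \<or> i = (j + 1) mod k"
    if "i < k" "j < k" for i j
    using assms eq[OF that(1), of j] eq[OF that(2), of i] unfolding induced_cycle_def by simp
  ultimately show ?thesis unfolding induced_cycle_def by blast
qed

section \<open>Heights in breadth-first orderings\<close>

text \<open>
  If \<open>p\<close> maps each position to that of its first neighbour in a breadth-first ordering starting
  with the edge \<open>s t\<close>, then \<open>height p\<close> at \<open>x\<close> is the minimum of \<open>2 dist(x, s)\<close> and \<open>2 dist(x, t) + 1\<close>.
\<close>

fun height :: "(nat \<Rightarrow> nat) \<Rightarrow> nat \<Rightarrow> nat" where
  "height p j = (if j < 2 then j else if p j < j then height p (p j) + 2 else 0)"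

declare height.simps[simp del]

context connected_pair_graph
begin

definition first_neighbour :: "'a list \<Rightarrow> nat \<Rightarrow> nat" where
  "first_neighbour \<sigma> j = (LEAST i. (\<sigma> ! i, \<sigma> ! j) \<in> E)"

lemma first_neighbour_le: "(\<sigma> ! i, \<sigma> ! j) \<in> E \<Longrightarrow> first_neighbour \<sigma> j \<le> i"
  unfolding first_neighbour_def by (rule Least_le)

context
  fixes \<sigma> :: "'a list"
  assumes bfs: "BFS_ordering G \<sigma>" and len: "2 \<le> length \<sigma>" and first_edge: "(\<sigma> ! 0, \<sigma> ! 1) \<in> E"
begin

abbreviation "par \<equiv> first_neighbour \<sigma>"
abbreviation "ht \<equiv> height par"

lemma par_edge:
  assumes "0 < j" "j < length \<sigma>"
  shows "par j < j" "(\<sigma> ! par j, \<sigma> ! j) \<in> E"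
proof -
  obtain i where i: "i < j" "(\<sigma> ! i, \<sigma> ! j) \<in> E"
    using BFS_search_order[OF bfs] assms unfolding search_order_def by blast
  show "(\<sigma> ! par j, \<sigma> ! j) \<in> E"
    unfolding first_neighbour_def using i(2) by (rule LeastI)
  show "par j < j" using first_neighbour_le[OF i(2)] i(1) by simp
qed

text \<open>If \<open>par j\<close> came before \<open>par i\<close>, the BFS condition for
  \<open>par j\<close>, \<open>i\<close>, \<open>j\<close> would give \<open>i\<close> a neighbour
  even before \<open>par j\<close>.\<close>

lemma par_mono:
  assumes "0 < i" "i \<le> j" "j < length \<sigma>"
  shows "par i \<le> par j"
proof (rule ccontr)
  assume less: "\<not> par i \<le> par j"
  have "i < length \<sigma>" "0 < j" using assms by auto
  then have "par j < i" using par_edge(1)[of i] assms less by simp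
  moreover have "i < j" using assms less by (cases "i = j") auto
  moreover have "(\<sigma> ! par j, \<sigma> ! i) \<notin> E" using first_neighbour_le less by blast
  moreover have "(\<sigma> ! par j, \<sigma> ! j) \<in> E" using par_edge(2) assms \<open>0 < j\<close> by blast
  ultimately obtain l where "l < par j" "(\<sigma> ! l, \<sigma> ! i) \<in> E"
    using bfs assms(3) unfolding BFS_ordering_iff by blast
  then show False using first_neighbour_le[of \<sigma> l i] less by simp
qed

lemma ht_0 [simp]: "ht 0 = 0" and ht_1 [simp]: "ht (Suc 0) = 1"
  by (simp_all add: height.simps)

lemma ht_par: "2 \<le> j \<Longrightarrow> j < length \<sigma> \<Longrightarrow> ht j = ht (par j) + 2"
  using par_edge(1)[of j] by (subst height.simps) auto

lemma ht_mono: "i \<le> j \<Longrightarrow> j < length \<sigma> \<Longrightarrow> ht i \<le> ht j"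
proof (induction j arbitrary: i rule: less_induct)
  case (less j)
  show ?case
  proof (cases "2 \<le> i")
    case True
    then have "ht (par i) \<le> ht (par j)"
      using less.IH[of "par j" "par i"] par_mono[of i j] par_edge(1)[of j] less.prems by auto
    then show ?thesis using ht_par True less.prems by simp
  next
    case False
    then have "i = 0 \<or> i = Suc 0" by auto
    then show ?thesis
      using ht_par[of j] less.prems by (cases "2 \<le> j") (auto simp: le_less_Suc_eq not_le less_Suc_eq numeral_2_eq_2)
  qed
qed

text \<open>The first neighbour of \<open>j\<close> is at or before \<open>i\<close>, so
  monotonicity bounds its height by that of \<open>i\<close>.\<close>

lemma ht_edge:
  assumes "i < length \<sigma>" "j < length \<sigma>" "(\<sigma> ! i, \<sigma> ! j) \<in> E"
  shows "ht j \<le> ht i + 2"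
proof (cases "2 \<le> j")
  case True
  have "ht (par j) \<le> ht i" using first_neighbour_le[OF assms(3)] assms(1) by (rule ht_mono)
  then show ?thesis using ht_par[OF True assms(2)] by simp
next
  case False
  then have "j = 0 \<or> j = Suc 0" by auto
  then show ?thesis by auto
qed

lemma ht_walk:
  "walk_in E S l (\<sigma> ! i) (\<sigma> ! j) \<Longrightarrow> i < length \<sigma> \<Longrightarrow> j < length \<sigma> \<Longrightarrow> ht j \<le> ht i + 2 * l"
proof (induction l arbitrary: i)
  case 0
  then have "i = j" using bfs nth_eq_iff_index_eq[of \<sigma> i j]
    by (auto simp: BFS_ordering_def vertex_ordering_def)
  then show ?case by simp
next
  case (Suc l)
  then obtain z where z: "(\<sigma> ! i, z) \<in> E" "walk_in E S l z (\<sigma> ! j)" by auto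
  then have "z \<in> set \<sigma>"
    using edge_verts bfs by (auto simp: BFS_ordering_def vertex_ordering_def)
  then obtain h where h: "h < length \<sigma>" "z = \<sigma> ! h" by (metis in_set_conv_nth)
  then show ?case using Suc ht_edge[of i h] z by fastforce
qed

text \<open>Iterating \<open>par\<close> ends at position 0 or 1 and lowers the height by 2 each
  time, so the height encodes both the length and the end of the walk. Positions decrease, which
  keeps the walk in the prefix.\<close>

lemma walk_to_root:
  "j < length \<sigma> \<Longrightarrow> \<exists>l z. z < 2 \<and> 2 * l + z = ht j \<and> walk_in E (set (take (Suc j) \<sigma>)) l (\<sigma> ! j) (\<sigma> ! z)"
proof (induction j rule: less_induct)
  case (less j)
  have mem: "\<sigma> ! j \<in> set (take (Suc j) \<sigma>)" using less.prems by (simp add: nth_in_set_take)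
  show ?case
  proof (cases "2 \<le> j")
    case True
    have pj: "par j < j" "(\<sigma> ! j, \<sigma> ! par j) \<in> E" using par_edge[of j] less.prems True edge_sym by auto
    then obtain l z where lz: "z < 2" "2 * l + z = ht (par j)"
      "walk_in E (set (take (Suc (par j)) \<sigma>)) l (\<sigma> ! par j) (\<sigma> ! z)"
      using less.IH[of "par j"] less.prems by auto
    have "walk_in E (set (take (Suc j) \<sigma>)) l (\<sigma> ! par j) (\<sigma> ! z)"
      using lz(3) by (rule walk_in_mono) (rule set_take_subset_set_take, use pj in simp)
    then have "walk_in E (set (take (Suc j) \<sigma>)) (Suc l) (\<sigma> ! j) (\<sigma> ! z)" using pj mem by auto
    moreover have "2 * Suc l + z = ht j" using lz(2) ht_par[OF True less.prems] by simp
    ultimately show ?thesis using lz(1) by blast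
  next
    case False
    then have "j = 0 \<or> j = Suc 0" by auto
    then have "2 * 0 + j = ht j" by auto
    moreover have "walk_in E (set (take (Suc j) \<sigma>)) 0 (\<sigma> ! j) (\<sigma> ! j)" using mem by simp
    ultimately show ?thesis using False by (metis not_le)
  qed
qed

end

section \<open>Breadth-first orderings that are not lexicographic\<close>

text \<open>Visiting \<open>y'\<close> next breaks LexBFS at \<open>xs ! i\<close>,
  \<open>y'\<close>, \<open>y\<close>, because the vertices before \<open>xs ! i\<close> do not
  distinguish \<open>y\<close> from \<open>y'\<close>.\<close>

lemma candidates_give_bad_BFS_aux:
  assumes b: "built bfs_step xs" and st: "bfs_step xs y" "bfs_step xs y'" and i: "i < length xs"
    "(xs ! i, y) \<in> E" "(xs ! i, y') \<notin> E" "\<And>l. l < i \<Longrightarrow> (xs ! l, y) \<in> E \<longleftrightarrow> (xs ! l, y') \<in> E"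
  shows "\<exists>\<sigma>. BFS_ordering G \<sigma> \<and> \<not> LexBFS_ordering G \<sigma>"
proof -
  have "built bfs_step (xs @ [y'])" using b st by (simp add: built_snoc)
  then obtain ys where s: "BFS_ordering G ((xs @ [y']) @ ys)" (is "BFS_ordering G ?s")
    using built_bfs_extend[of "xs @ [y']"] by auto
  have y: "y \<in> V - set xs" "y \<noteq> y'" using st i by (auto simp: bfs_step_def)
  then have "y \<in> set ?s" using s by (simp add: BFS_ordering_def vertex_ordering_def)
  then obtain k where k: "k < length ?s" "?s ! k = y" by (meson in_set_conv_nth)
  have jk: "length xs < k"
  proof (rule ccontr)
    assume "\<not> length xs < k"
    then show False using k y by (auto simp: nth_append split: if_splits)
  qed
  have pre: "?s ! l = xs ! l" if "l < length xs" for l using that by (simp add: nth_append)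
  have y': "?s ! length xs = y'" by (simp add: nth_append)
  have "\<not> LexBFS_ordering G ?s"
  proof
    assume "LexBFS_ordering G ?s"
    then have "(?s ! i, ?s ! k) \<in> E \<longrightarrow> (?s ! i, ?s ! length xs) \<notin> E \<longrightarrow>
        (\<exists>l<i. (?s ! l, ?s ! length xs) \<in> E \<and> (?s ! l, ?s ! k) \<notin> E)"
      using i(1) jk k(1) unfolding LexBFS_ordering_iff by blast
    then obtain l where l: "l < i" "(?s ! l, y') \<in> E" "(?s ! l, y) \<notin> E"
      unfolding k(2) y' pre[OF i(1)] using i(2,3) by blast
    moreover have "?s ! l = xs ! l" using l(1) i(1) by (intro pre) simp
    ultimately show False using i(4) by simp
  qed
  with s show ?thesis by blast
qed

text \<open>Take the first visited vertex adjacent to exactly one of the two candidates and visit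
  the other candidate next.\<close>

lemma candidates_give_bad_BFS:
  assumes b: "built bfs_step xs" and st: "bfs_step xs y" "bfs_step xs y'"
    and d: "d \<in> set xs" "(d, y) \<in> E" "(d, y') \<notin> E"
  shows "\<exists>\<sigma>. BFS_ordering G \<sigma> \<and> \<not> LexBFS_ordering G \<sigma>"
proof -
  let ?P = "\<lambda>i. i < length xs \<and> ((xs ! i, y) \<in> E \<longleftrightarrow> (xs ! i, y') \<notin> E)"
  have "\<exists>i. ?P i" using d by (metis in_set_conv_nth)
  then obtain i where i: "?P i" "\<And>l. l < i \<Longrightarrow> \<not> ?P l" using exists_least_iff[of ?P] by blast
  then have agree: "(xs ! l, y) \<in> E \<longleftrightarrow> (xs ! l, y') \<in> E" if "l < i" for l
    using that less_trans by blast
  show ?thesis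
  proof (cases "(xs ! i, y) \<in> E")
    case True
    then show ?thesis using candidates_give_bad_BFS_aux[OF b st] i(1) agree by blast
  next
    case False
    then show ?thesis using candidates_give_bad_BFS_aux[OF b st(2,1)] i(1) agree by blast
  qed
qed

lemma built_bfs_edge:
  assumes "(u, x) \<in> E"
  shows "built bfs_step [u, x]"
proof -
  have "bfs_step [] u" using edge_verts[OF assms] by (simp add: bfs_step_def)
  moreover have "bfs_step [u] x"
    using assms edge_verts no_loop by (intro bfs_stepI[of 0]) auto
  ultimately have "built bfs_step (([] @ [u]) @ [x])"
    unfolding built_snoc by (simp add: built_def)
  then show ?thesis by simp
qed

text \<open>After \<open>u\<close> and \<open>x\<close>, both \<open>y\<close> and \<open>z\<close>
  are legal as neighbours of the root \<open>u\<close>, and \<open>x\<close> distinguishes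
  them.\<close>

lemma star_gives_bad_BFS:
  assumes "(u, x) \<in> E" "(u, y) \<in> E" "(u, z) \<in> E" "(x, y) \<in> E" "(x, z) \<notin> E" "x \<noteq> z"
  shows "\<exists>\<sigma>. BFS_ordering G \<sigma> \<and> \<not> LexBFS_ordering G \<sigma>"
proof (rule candidates_give_bad_BFS[OF built_bfs_edge[OF assms(1)]])
  have "y \<noteq> u" "y \<noteq> x" "z \<noteq> u" using assms no_loop by auto
  moreover have "y \<in> V" "z \<in> V" using assms edge_verts by blast+
  ultimately show "bfs_step [u, x] y" "bfs_step [u, x] z"
    using assms by (auto intro!: bfs_stepI[of 0])
qed (use assms in auto)

lemma diamond_gives_bad_BFS:
  assumes "\<not> no_diamond E"
  shows "\<exists>\<sigma>. BFS_ordering G \<sigma> \<and> \<not> LexBFS_ordering G \<sigma>"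
proof -
  obtain x y u v where "(u, v) \<in> E" "(x, u) \<in> E" "(x, v) \<in> E" "(y, u) \<in> E" "(y, v) \<in> E"
    "x \<noteq> y" "(x, y) \<notin> E"
    using assms unfolding no_diamond_def by blast
  moreover from this have "(u, x) \<in> E" "(u, y) \<in> E" using edge_sym by blast+
  ultimately show ?thesis using star_gives_bad_BFS[of u x v y] by blast
qed

lemma paw_gives_bad_BFS:
  assumes "induced_pan E 3 c w"
  shows "\<exists>\<sigma>. BFS_ordering G \<sigma> \<and> \<not> LexBFS_ordering G \<sigma>"
proof (rule star_gives_bad_BFS)
  have cyc: "induced_cycle E 3 c" and w: "w \<notin> c ` {..<3}"
    and wE: "\<And>i. i < 3 \<Longrightarrow> (c i, w) \<in> E \<longleftrightarrow> i = 0"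
    using assms unfolding induced_pan_def by auto
  show "(c 0, c 1) \<in> E" "(c 0, c 2) \<in> E" "(c 1, c 2) \<in> E"
    using induced_cycle_edge_iff[OF cyc] by auto
  show "(c 0, w) \<in> E" "(c 1, w) \<notin> E" using wE by auto
  show "c 1 \<noteq> w" using w by auto
qed

section \<open>A smallest pan whose cycle has length at least four\<close>

lemma minimal_pan_gives_bad_BFS:
  assumes nd: "no_diamond E" and np: "no_pan_below E k" and pan: "induced_pan E k c w" and k: "4 \<le> k"
  shows "\<exists>\<sigma>. BFS_ordering G \<sigma> \<and> \<not> LexBFS_ordering G \<sigma>"
proof -
  have cyc: "induced_cycle E k c" and w: "w \<notin> c ` {..<k}"
    and wE: "\<And>i. i < k \<Longrightarrow> (c i, w) \<in> E \<longleftrightarrow> i = 0"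
    using pan unfolding induced_pan_def by auto
  note edge = induced_cycle_edge_iff[OF cyc] and neq = induced_cycle_neq[OF cyc]
  \<comment> \<open>Cyclic indexing is used because \<open>m + 2\<close> equals \<open>k\<close>
    when \<open>k = 4\<close>, and \<open>C (m + 2)\<close> is then \<open>c 0\<close>.\<close>
  define C where "C i = c (i mod k)" for i
  have C_eq: "C i = c i" if "i < k" for i using that by (simp add: C_def)
  have Ck: "C k = c 0" by (simp add: C_def)
  have C_edge: "(C i, C (Suc i)) \<in> E" for i
    using cyc k unfolding induced_cycle_def C_def by (simp add: mod_Suc_eq)
  have C_w: "C i \<noteq> w" for i using w k by (auto simp: C_def)
  have C_1: "C i \<noteq> c 1" if "2 \<le> i" "i \<le> k" for i
    using neq[of i 1] neq[of 0 1] that k by (cases "i = k") (auto simp: C_eq Ck)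
  define m where "m = k div 2"
  have m: "k = 2 * m \<or> k = 2 * m + 1" "2 \<le> m" "m + 2 \<le> k" using k by (auto simp: m_def)

  text \<open>The search starts with the edge of the cycle opposite to \<open>c 1\<close>; of its ends, the one
    that comes first is chosen so that \<open>c 0\<close> is lower than \<open>c 2\<close>.\<close>
  define zp :: nat where "zp = (if even k then 0 else 1)"
  define zq :: nat where "zq = (if even k then 1 else 0)"
  have z2: "zp < 2" "zq < 2" "z < 2 \<Longrightarrow> z = zp \<or> z = zq" for z by (auto simp: zp_def zq_def)
  \<comment> \<open>The parity of \<open>k\<close> is absorbed into \<open>zp\<close> and
    \<open>zq\<close>, which leaves linear arithmetic for most height bounds.\<close>
  have kz: "k + zp = 2 * m + 2 * zp" "k + 1 = 2 * m + 1 + zp" "zp + zq = 1"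
    using m(1) by (auto simp: zp_def zq_def)
  have "\<exists>\<sigma>. BFS_ordering G \<sigma> \<and> 2 \<le> length \<sigma> \<and> \<sigma> ! zp = C (m + 1) \<and> \<sigma> ! zq = C (m + 2)"
  proof (cases "even k")
    case True
    have "built bfs_step [C (m + 1), C (m + 2)]" using C_edge[of "m + 1"] by (intro built_bfs_edge) simp
    then obtain ys where "BFS_ordering G ([C (m + 1), C (m + 2)] @ ys)" using built_bfs_extend by blast
    then show ?thesis using True by (intro exI[of _ "[C (m + 1), C (m + 2)] @ ys"]) (simp add: zp_def zq_def)
  next
    case False
    have "built bfs_step [C (m + 2), C (m + 1)]" using C_edge[of "m + 1"] edge_sym by (intro built_bfs_edge) simp
    then obtain ys where "BFS_ordering G ([C (m + 2), C (m + 1)] @ ys)" using built_bfs_extend by blast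
    then show ?thesis using False by (intro exI[of _ "[C (m + 2), C (m + 1)] @ ys"]) (simp add: zp_def zq_def)
  qed
  then obtain \<sigma> where bfs: "BFS_ordering G \<sigma>" and len: "2 \<le> length \<sigma>"
    and zp: "\<sigma> ! zp = C (m + 1)" and zq: "\<sigma> ! zq = C (m + 2)" by blast
  have edge_pq: "(C (m + 1), C (m + 2)) \<in> E" "(C (m + 2), C (m + 1)) \<in> E"
    using C_edge[of "m + 1"] edge_sym by auto
  have first: "(\<sigma> ! 0, \<sigma> ! 1) \<in> E"
    using zp zq edge_pq by (cases "even k") (auto simp: zp_def zq_def)
  have dist: "distinct \<sigma>" and set: "set \<sigma> = V"
    using bfs by (auto simp: BFS_ordering_def vertex_ordering_def)
  let ?N = "length \<sigma>"
  let ?par = "first_neighbour \<sigma>"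
  let ?ht = "height ?par"
  note par_edge = par_edge[OF bfs len first] and par_mono = par_mono[OF bfs len first]
    and ht_par = ht_par[OF bfs len first] and ht_mono = ht_mono[OF bfs len first]
    and ht_edge = ht_edge[OF bfs len first] and ht_walk = ht_walk[OF bfs len first]
    and walk_to_root = walk_to_root[OF bfs len first]
  have ht_z: "?ht z = z" if "z < 2" for z using that by (simp add: height.simps)
  have zN: "zp < ?N" "zq < ?N" using z2 len by auto
  have index: "\<exists>i<?N. \<sigma> ! i = x" if "x \<in> V" for x using that set by (metis in_set_conv_nth)
  have V: "c 0 \<in> V" "c 1 \<in> V" "c 2 \<in> V" "w \<in> V"
    using edge_verts edge[of 0 1] edge[of 1 2] wE[of 0] k by auto
  obtain i0 where i0: "i0 < ?N" "\<sigma> ! i0 = c 0" using index[OF V(1)] by blast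
  obtain i1 where i1: "i1 < ?N" "\<sigma> ! i1 = c 1" using index[OF V(2)] by blast
  obtain i2 where i2: "i2 < ?N" "\<sigma> ! i2 = c 2" using index[OF V(3)] by blast
  obtain iw where iw: "iw < ?N" "\<sigma> ! iw = w" using index[OF V(4)] by blast

  have walk_0: "walk_in E (- {c 1, w}) (k - m - 2) (C (m + 2)) (c 0)"
    unfolding walk_in_iff_fun
  proof (intro exI[of _ "\<lambda>t. C (m + 2 + t)"] conjI allI impI)
    have "m + 2 + (k - m - 2) = k" using m(3) by simp
    then show "C (m + 2 + (k - m - 2)) = c 0" by (simp only: Ck)
    show "C (m + 2 + t) \<in> - {c 1, w}" if "t \<le> k - m - 2" for t
      using C_1[of "m + 2 + t"] C_w that m(3) by simp
  qed (use C_edge in simp_all)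
  \<comment> \<open>Walks along the cycle give the upper bounds \<open>k - 3\<close> for
    \<open>c 0\<close> and \<open>k - 2\<close> for \<open>c 2\<close>; isometry gives the lower
    bound \<open>k - 1\<close> for \<open>c 1\<close>.\<close>
  have ht_0: "?ht i0 \<le> k - 3"
  proof -
    have "?ht i0 \<le> ?ht zq + 2 * (k - m - 2)"
      by (rule ht_walk[of "- {c 1, w}"]) (use walk_0 i0 zq zN in auto)
    then show ?thesis using ht_z[OF z2(2)] kz m(2,3) by linarith
  qed
  have ht_2: "?ht i2 \<le> k - 2"
  proof -
    have "walk_in E UNIV (m - 1) (C 2) (C (m + 1))"
      unfolding walk_in_iff_fun using C_edge m by (intro exI[of _ "\<lambda>t. C (2 + t)"]) auto
    then have "walk_in E UNIV (m - 1) (C (m + 1)) (c 2)" using walk_in_rev[OF sym_E] C_eq[of 2] k by simp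
    then have "?ht i2 \<le> ?ht zp + 2 * (m - 1)"
      by (intro ht_walk[of UNIV]) (use i2 zp zN in auto)
    then show ?thesis using ht_z[OF z2(1)] kz m(2,3) by linarith
  qed
  \<comment> \<open>Isometry with the base point moved to \<open>C s\<close>, where
    \<open>c 1\<close> gets the index \<open>k + 1 - s\<close>.\<close>
  have far: "min (k + 1 - s) (s - 1) \<le> L" if "walk_in E UNIV L (c 1) (C s)" "2 \<le> s" "s \<le> k" for L s
  proof -
    let ?c = "\<lambda>t. c ((s + t) mod k)"
    have "induced_cycle E k ?c" using induced_cycle_rotate[OF cyc] k by simp
    moreover have "?c (k + 1 - s) = c 1" "?c 0 = C s"
      using that k by (auto simp: C_def mod_Suc)
    ultimately have "min (k + 1 - s) (k - (k + 1 - s)) \<le> L"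
      using induced_cycle_isometric[OF sym_E irrefl_E nd np k, of ?c L "k + 1 - s"] that by simp
    then show ?thesis using that by simp
  qed
  have ht_1: "k - 1 \<le> ?ht i1"
  proof -
    obtain l z where lz: "z < 2" "2 * l + z = ?ht i1"
      "walk_in E (set (take (Suc i1) \<sigma>)) l (\<sigma> ! i1) (\<sigma> ! z)"
      using walk_to_root[OF i1(1)] by blast
    have wk: "walk_in E UNIV l (c 1) (\<sigma> ! z)" using walk_in_mono[OF lz(3)] i1 by simp
    show ?thesis
    proof (cases "z = zp")
      case True
      then have "min (k - m) m \<le> l" using far[of l "m + 1"] wk zp m by simp
      then show ?thesis using lz(2) m True by (auto simp: zp_def)
    next
      case False
      then have z: "z = zq" using z2 lz(1) by blast
      then have "min (k - m - 1) (m + 1) \<le> l" using far[of l "m + 2"] wk zq m by simp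
      then show ?thesis using lz(2) m z by (auto simp: zq_def)
    qed
  qed
  \<comment> \<open>By its height \<open>x\<close> precedes \<open>c 1\<close>, so its walk to the
    starting edge avoids \<open>c 1\<close> and \<open>w\<close>, and the cycle leads on to
    \<open>c 0\<close>. Length \<open>k - 3\<close> is the largest that
    \<open>closed_walk_pendant_adjacent\<close> accepts under
    \<open>no_pan_below E k\<close>.\<close>
  have walk: "\<exists>l\<le>k - 3. walk_in E (- {c 1, w}) l (\<sigma> ! x) (c 0)"
    if x: "x < iw" "?ht x \<le> k - 3" for x
  proof -
    have xN: "x < ?N" using x iw by simp
    have "x < i1" using ht_mono[of i1 x] xN x ht_1 k by (cases "x < i1") auto
    then have "\<sigma> ! q \<noteq> c 1 \<and> \<sigma> ! q \<noteq> w" if "q \<le> x" for q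
      using that x i1 iw nth_eq_iff_index_eq[OF dist, of q i1] nth_eq_iff_index_eq[OF dist, of q iw] by simp
    then have "\<sigma> ! q \<in> - {c 1, w}" if "q \<le> x" for q using that by simp
    then have sub: "set (take (Suc x) \<sigma>) \<subseteq> - {c 1, w}"
      by (force simp: in_set_conv_nth less_Suc_eq_le simp del: Compl_iff)
    obtain l z where lz: "z < 2" "2 * l + z = ?ht x"
      "walk_in E (set (take (Suc x) \<sigma>)) l (\<sigma> ! x) (\<sigma> ! z)"
      using walk_to_root[OF xN] by blast
    note wk = walk_in_mono[OF lz(3) sub]
    show ?thesis
    proof (cases "z = zq")
      case True
      then have "walk_in E (- {c 1, w}) (l + (k - m - 2)) (\<sigma> ! x) (c 0)"
        using walk_in_append[OF wk] walk_0 zq by simp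
      moreover have "l + (k - m - 2) \<le> k - 3" using lz(2) x(2) m kz True by linarith
      ultimately show ?thesis by blast
    next
      case False
      then have z: "z = zp" using z2 lz(1) by blast
      have "walk_in E (- {c 1, w}) (Suc l) (\<sigma> ! x) (C (m + 2))"
        by (rule walk_in_snoc[OF wk]) (use z zp edge_pq C_1[of "m + 2"] C_w m in auto)
      then have "walk_in E (- {c 1, w}) (Suc l + (k - m - 2)) (\<sigma> ! x) (c 0)"
        using walk_0 by (rule walk_in_append)
      moreover have "Suc l + (k - m - 2) \<le> k - 3" using lz(2) x(2) m kz z by linarith
      ultimately show ?thesis by blast
    qed
  qed
  have e0: "(c 0, w) \<in> E" "(w, c 0) \<in> E" "(c 0, c 1) \<in> E" "(c 1, c 0) \<in> E" "c 1 \<noteq> w"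
    using wE[of 0] edge[of 0 1] edge_sym k C_w[of 1] C_eq[of 1] by auto
  have ge2: "2 \<le> i" if "\<sigma> ! i \<noteq> C (m + 1)" "\<sigma> ! i \<noteq> C (m + 2)" for i
    using that zp zq z2(3)[of i] by (auto simp: not_le[symmetric])
  have iw2: "2 \<le> iw" using ge2[of iw] iw C_w by metis
  have i12: "2 \<le> i1" using ge2[of i1] i1 C_1[of "m + 1"] C_1[of "m + 2"] m by simp
  define e where "e = ?par iw"
  have e: "e < iw" "(\<sigma> ! e, w) \<in> E" "e \<le> i0"
    using par_edge[of iw] iw iw2 first_neighbour_le[of \<sigma> i0 iw] e0 i0 by (auto simp: e_def)
  have ht_e: "?ht e \<le> k - 3" using ht_mono[OF e(3) i0(1)] ht_0 by simp
  \<comment> \<open>Unless the first neighbour of \<open>w\<close> is \<open>c 0\<close>, the walk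
    from it through \<open>w\<close> and \<open>c 0\<close> to \<open>c 1\<close> makes it adjacent
    to \<open>c 1\<close>.\<close>
  have e1: "(\<sigma> ! e, c 1) \<in> E"
  proof (cases "\<sigma> ! e = c 0")
    case False
    obtain l where l: "l \<le> k - 3" "walk_in E (- {c 1, w}) l (\<sigma> ! e) (c 0)"
      using walk[OF e(1) ht_e] by blast
    show ?thesis
      by (rule closed_walk_pendant_adjacent[OF sym_E irrefl_E nd np l(2)])
        (use l(1) k e(2) e0 False in auto)
  qed (use e0 in simp)
  define d where "d = ?par i1"
  have d: "d < i1" "(\<sigma> ! d, c 1) \<in> E" "d \<le> e"
    using par_edge[of i1] i1 i12 first_neighbour_le[of \<sigma> e i1] e1 by (auto simp: d_def)
  have ht_d: "?ht d \<le> k - 3" using ht_mono[OF d(3)] ht_e e(1) iw(1) by simp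
  \<comment> \<open>The same argument with \<open>c 1\<close> and \<open>w\<close> exchanged;
    together the two show that \<open>c 1\<close> and \<open>w\<close> have the same first
    neighbour.\<close>
  have dw: "(\<sigma> ! d, w) \<in> E"
  proof (cases "\<sigma> ! d = c 0")
    case False
    have "d < iw" using d(3) e(1) by simp
    then obtain l where l: "l \<le> k - 3" "walk_in E (- {w, c 1}) l (\<sigma> ! d) (c 0)"
      using walk[OF _ ht_d] by (auto simp: insert_commute)
    show ?thesis
      by (rule closed_walk_pendant_adjacent[OF sym_E irrefl_E nd np l(2)])
        (use l(1) k d(2) e0 False in auto)
  qed (use e0 in simp)
  have "e \<le> d" using first_neighbour_le[of \<sigma> d iw] dw iw by (simp add: e_def)
  with d(3) have de: "d = e" by simp
  have ht_i1: "?ht i1 = ?ht e + 2" using ht_par[OF i12 i1(1)] de by (simp add: d_def)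

  \<comment> \<open>The first vertex discovered from \<open>e\<close>; here the search may take any
    unvisited neighbour of \<open>e\<close> instead. Position 0 is excluded because its first
    neighbour, position 1, is not an earlier one.\<close>
  define f where "f = (LEAST j. 0 < j \<and> ?par j = e)"
  have P1: "0 < i1 \<and> ?par i1 = e" and Pw: "0 < iw \<and> ?par iw = e"
    using i12 iw2 de by (auto simp: d_def e_def)
  have f: "0 < f" "?par f = e" using LeastI[of "\<lambda>j. 0 < j \<and> ?par j = e", OF P1] by (auto simp: f_def)
  have fi: "f \<le> i1" "f \<le> iw"
    using Least_le[of "\<lambda>j. 0 < j \<and> ?par j = e", OF P1] Least_le[of "\<lambda>j. 0 < j \<and> ?par j = e", OF Pw]
    by (auto simp: f_def)
  have fN: "f < ?N" using fi i1 by simp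
  have ef: "e < f" using par_edge(1)[OF f(1) fN] f(2) by simp
  have e_pos: "0 < e" using ht_i1 ht_1 k ht_z[of 0] by (cases e) auto
  then have "2 \<le> f" using ef by simp
  then have "?ht f = ?ht e + 2" using ht_par[OF _ fN] f(2) by simp
  \<comment> \<open>Positions \<open>f\<close> and \<open>i1\<close> share the first neighbour
    \<open>e\<close> and hence their height, which exceeds that of \<open>c 2\<close>.\<close>
  then have "?ht i2 < ?ht f" using ht_2 ht_1 ht_i1 k by linarith
  then have i2f: "i2 < f" using ht_mono[of f i2] i2(1) by (cases "i2 < f") auto
  \<comment> \<open>By monotonicity of first neighbours, vertices from position \<open>f\<close> on
    have none before \<open>e\<close>. So any neighbour of \<open>e\<close> among them is a legal
    choice at \<open>f\<close>.\<close>
  have step: "bfs_step (take f \<sigma>) (\<sigma> ! x)" if x: "f \<le> x" "x < ?N" "(\<sigma> ! e, \<sigma> ! x) \<in> E" for x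
  proof (rule bfs_stepI[of e])
    have vo: "vertex_ordering G \<sigma>" using bfs by (simp add: BFS_ordering_def)
    show "e < length (take f \<sigma>)" using ef fN by simp
    show "\<sigma> ! x \<in> V - set (take f \<sigma>)" by (rule vertex_ordering_unvisited[OF vo x(1,2)])
    show "(take f \<sigma> ! e, \<sigma> ! x) \<in> E" using x(3) ef by simp
    fix l y assume l: "l < e" and y: "y \<in> V - set (take f \<sigma>)"
    then obtain q where q: "q < ?N" "\<sigma> ! q = y" using index by blast
    have "f \<le> q"
    proof (rule ccontr)
      assume "\<not> f \<le> q"
      then have "y \<in> set (take f \<sigma>)" using q fN nth_in_set_take[of q f \<sigma>] by simp
      with y show False by blast
    qed
    then have "e \<le> ?par q" using par_mono[OF f(1) _ q(1)] f(2) by simp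
    then have "(\<sigma> ! l, y) \<notin> E" using first_neighbour_le[of \<sigma> l q] q(2) l by auto
    then show "(take f \<sigma> ! l, y) \<notin> E" using l ef by simp
  qed
  have "built bfs_step (take f \<sigma> @ drop f \<sigma>)" using built_bfs_iff_BFS_ordering[of \<sigma>] bfs by simp
  then have "built bfs_step (take f \<sigma>)" by (rule built_append)
  then show ?thesis
  proof (rule candidates_give_bad_BFS)
    show "bfs_step (take f \<sigma>) (c 1)" using step[OF fi(1) i1(1)] i1(2) e1 by simp
    show "bfs_step (take f \<sigma>) w" using step[OF fi(2) iw(1)] iw(2) e(2) by simp
    show "c 2 \<in> set (take f \<sigma>)" using nth_in_set_take[OF i2f, of \<sigma>] fN i2(2) by simp
    show "(c 2, c 1) \<in> E" using edge[of 1 2] edge_sym k by auto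
    show "(c 2, w) \<notin> E" using wE[of 2] k by simp
  qed
qed

text \<open>Induction on \<open>k\<close> descends to a smallest pan, after diamonds have been dealt
  with directly.\<close>

lemma pan_gives_bad_BFS:
  assumes "induced_pan E k c w"
  shows "\<exists>\<sigma>. BFS_ordering G \<sigma> \<and> \<not> LexBFS_ordering G \<sigma>"
  using assms
proof (induction k arbitrary: c w rule: less_induct)
  case (less k)
  show ?case
  proof (cases "no_diamond E \<and> no_pan_below E k")
    case False
    then show ?thesis
      using less.IH diamond_gives_bad_BFS unfolding no_pan_below_def by blast
  next
    case True
    show ?thesis
    proof (cases "k = 3")
      case True
      then show ?thesis using less.prems paw_gives_bad_BFS by blast
    next
      case False
      then have "4 \<le> k" using less.prems by (simp add: induced_pan_def)
      then show ?thesis using minimal_pan_gives_bad_BFS less.prems True by blast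
    qed
  qed
qed

end

section \<open>The three equivalences\<close>

theorem theorem2:
  fixes G :: "'a pair_pre_digraph"
  assumes "pair_graph G" and "connected (with_proj G)"
  shows "(pan_diamond_free G \<longleftrightarrow>
            (\<forall>\<sigma>. DFS_ordering G \<sigma> \<longrightarrow> LexDFS_ordering G \<sigma>)) \<and>
         (pan_diamond_free G \<longleftrightarrow>
            (\<forall>\<sigma>. BFS_ordering G \<sigma> \<longrightarrow> LexBFS_ordering G \<sigma>)) \<and>
         (pan_diamond_free G \<longleftrightarrow>
            (\<forall>\<sigma>. graph_search_ordering G \<sigma> \<longrightarrow> MNS_ordering G \<sigma>))"
proof -
  have G: "connected_pair_graph G"
    by (intro connected_pair_graph.intro connected_pair_graph_axioms.intro assms)
  note bad_DFS = connected_pair_graph.pan_gives_bad_DFS[OF G] connected_pair_graph.diamond_gives_bad_DFS[OF G]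
  note bad_BFS = connected_pair_graph.pan_gives_bad_BFS[OF G] connected_pair_graph.diamond_gives_bad_BFS[OF G]
  note lex = connected_pair_graph.pan_diamond_free_imp_lex[OF G]
  have bad: "(\<exists>\<sigma>. DFS_ordering G \<sigma> \<and> \<not> LexDFS_ordering G \<sigma> \<and> \<not> MNS_ordering G \<sigma>)"
      "(\<exists>\<sigma>. BFS_ordering G \<sigma> \<and> \<not> LexBFS_ordering G \<sigma>)" if "\<not> pan_diamond_free G"
    using that bad_DFS bad_BFS unfolding pan_diamond_free_iff[OF assms(1)] no_pan_below_def by metis+
  \<comment> \<open>The DFS ordering that violates MNS is itself a graph search ordering and so
    refutes the last statement as well.\<close>
  have "graph_search_ordering G \<sigma>" if "DFS_ordering G \<sigma>" for \<sigma>
    using connected_pair_graph.DFS_search_order[OF G that] that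
    by (simp add: connected_pair_graph.graph_search_ordering_iff[OF G] DFS_ordering_def)
  then show ?thesis using lex bad by metis
qed

end
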